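(* Let $f=x\oplus y\oplus z\oplus 0$ and let $g=\bigoplus_{a+b+c\le m}\alpha_{abc}x^ay^bz^c$ be a tropical polynomial with $\mathrm{Newt}(g)=\mathrm{Conv}(\{(0,0,0),(m,0,0),(0,m,0),(0,0,m)\})$ such that $C=\mathbf{V}(f)\cap\mathbf{V}(g)$ is a smooth tropical complete intersection curve. Let $x^{a_0}y^{b_0}z^{c_0}$ be the monomial of $g$ corresponding to the domain of $\mathbb{R}^3\setminus\mathbf{V}(g)$ containing $(0,0,0)$. Let $K'$ be the complex of marked cells, and let $u:[0,a_0]\to\mathbb{R}$, $r:[0,b_0]\to\mathbb{R}$, $U$ and $R$ be as defined in the context. Then $$|K'|=\mathbb{R}^2_{\ge 0}\setminus\left\{(x,y)\in\mathbb{R}^2\ \middle|\ \begin{array}{l}0\le x\le a_0,\ y>u(x),\ \text{or}\\ 0\le y\le b_0,\ x>r(y),\ \text{or}\\ x>a_0,\ y>b_0\end{array}\right\}=\Delta_m\setminus\bigl(U\cup R\cup\{(x,y)\mid x>a_0,\ y>b_0\}\bigr).$$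
   Context: Tropical operations: $x\oplus y=\max(x,y)$, $x\odot y=x+y$ on $\mathbb{R}\cup\{-\infty\}$. For a tropical polynomial $p=\bigoplus_i\alpha_i x^{a_i}\ne-\infty$ in $n$ variables (absent monomials have coefficient $-\infty$), $\mathbf{V}(p)\subset\mathbb{R}^n$ is the set of points $t$ where the maximum of the values $\alpha_i+a_i\cdot t$ is attained by at least two terms; $\mathrm{Newt}(p)$ is the convex hull of the exponents with finite coefficient. A domain of $\mathbb{R}^n\setminus\mathbf{V}(p)$ is a connected component; on it a unique term attains the maximum, and the domain is said to correspond to that term (monomial). Smooth complete intersection: for tropical polynomials $p,q$ in three variables with terms $\alpha_i x^{a_i}y^{b_i}z^{c_i}$, $\beta_j x^{a'_j}y^{b'_j}z^{c'_j}$ and $P=\mathrm{Newt}(p)$, $Q=\mathrm{Newt}(q)$, the Cayley subdivision of $\mathrm{Cay}(P,Q)=\mathrm{Conv}((P\times\{0\})\cup(Q\times\{1\}))\subset\mathbb{R}^4$ consists of the projections of the bounded faces of $\mathrm{Conv}(\{(a_i,b_i,c_i,0,\alpha)\mid\alpha\le\alpha_i\}\cup\{(a'_j,b'_j,c'_j,1,\beta)\mid\beta\le\beta_j\})\subset\mathbb{R}^5$. $\mathbf{V}(p)\cap\mathbf{V}(q)$ is a smooth complete intersection curve if all $4$-dimensional cells of this subdivision have volume $1/24$. Under the hypotheses, $(0,0,0)\notin\mathbf{V}(g)$, so $(a_0,b_0,c_0)$ is well defined. Let $g|_{z=0}=\bigoplus_{a+b\le m}\alpha_{ab}x^ay^b$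 with $\alpha_{ab}=\max(\alpha_{ab0},\dots,\alpha_{a,b,m-a-b})$. Its Newton polygon is $\Delta_m=\mathrm{Conv}(\{(0,0),(m,0),(0,m)\})$. Let $K$ be the dual subdivision of $\Delta_m$, i.e. the polyhedral complex of projections to $\mathbb{R}^2$ of the bounded faces of $\mathrm{Conv}(\{(a,b,\alpha)\mid\alpha\le\alpha_{ab}\})$. Let $\tilde K$ be the polyhedral complex consisting of the vertices and edges of $\mathbf{V}(g|_{z=0})$ and the closures of the domains of $\mathbb{R}^2\setminus\mathbf{V}(g|_{z=0})$; it is dual to $K$: a cell $Q$ of $K$ corresponds to the cell of $\tilde K$ of points where all the terms of $g|_{z=0}$ with exponent a vertex of $Q$ attain the maximum. A cell of $K$ is marked if the corresponding cell of $\tilde K$ intersects $\mathbb{R}^2_{\le0}$; $K'$ is the subcomplex of marked cells, and $|K'|$ is its underlying set. Put $X=\{(x,0)\mid x\le0\}$ and $Y=\{(0,y)\mid y\le0\}$. For each integer $i\in\{0,\dots,a_0\}$ there is a unique integer $u(i)$ such that $(i,u(i))$ is a vertex of $K'$ whose corresponding domain intersects $X$; for each integer $j\in\{0,\dots,b_0\}$ there is a unique integer $r(j)$ such that $(r(j),j)$ is a vertex of $K'$ whose corresponding domain intersects $Y$. Extend $u$ to $[0,a_0]$ and $r$ to $[0,b_0]$ by linear interpolation between consecutive integers. Put $U=\{(x,y)\mid0\le x\le a_0,\ y>u(x)\}$ and $R=\{(x,y)\mid0\le y\le b_0,\ x>r(y)\}$. *)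

theory Defs
  imports "HOL-Analysis.Analysis"
begin

text \<open>
  A tropical polynomial in variables indexed by a finite type is its coefficient function on
  exponent vectors, with values in the reals extended by \<open>-\<infinity>\<close>; absent monomials have
  coefficient \<open>-\<infinity>\<close>.
\<close>

definition trop_supp :: "(nat ^ 'n \<Rightarrow> ereal) \<Rightarrow> (nat ^ 'n) set" where
  "trop_supp p = {e. p e \<noteq> -\<infinity>}"

definition trop_poly :: "(nat ^ 'n \<Rightarrow> ereal) \<Rightarrow> bool" where
  "trop_poly p \<longleftrightarrow> finite (trop_supp p) \<and> (\<forall>e. p e \<noteq> \<infinity>)"

definition real_vec :: "nat ^ 'n \<Rightarrow> real ^ 'n" where
  "real_vec e = (\<chi> i. real (e $ i))"

definition term_value :: "(nat ^ 'n \<Rightarrow> ereal) \<Rightarrow> nat ^ 'n \<Rightarrow> real ^ 'n \<Rightarrow> ereal" where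
  "term_value p e t = p e + ereal (real_vec e \<bullet> t)"

definition max_terms :: "(nat ^ 'n \<Rightarrow> ereal) \<Rightarrow> real ^ 'n \<Rightarrow> (nat ^ 'n) set" where
  "max_terms p t = {e \<in> trop_supp p. \<forall>e'. term_value p e' t \<le> term_value p e t}"

definition trop_variety :: "(nat ^ 'n \<Rightarrow> ereal) \<Rightarrow> (real ^ 'n) set" where
  "trop_variety p = {t. \<exists>e e'. e \<noteq> e' \<and> e \<in> max_terms p t \<and> e' \<in> max_terms p t}"

definition newt :: "(nat ^ 'n \<Rightarrow> ereal) \<Rightarrow> (real ^ 'n) set" where
  "newt p = convex hull (real_vec ` trop_supp p)"

definition corresponds :: "(nat ^ 'n \<Rightarrow> ereal) \<Rightarrow> (real ^ 'n) set \<Rightarrow> nat ^ 'n \<Rightarrow> bool" where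
  "corresponds p D e \<longleftrightarrow>
     D \<in> components (- trop_variety p) \<and> (\<forall>t\<in>D. max_terms p t = {e})"

text \<open>Meaningful only for \<open>t\<close> outside \<open>trop_variety p\<close>.\<close>

definition exponent_at :: "(nat ^ 'n \<Rightarrow> ereal) \<Rightarrow> real ^ 'n \<Rightarrow> nat ^ 'n" where
  "exponent_at p t = (THE e. \<exists>D. t \<in> D \<and> corresponds p D e)"

text \<open>
  The last real coordinate of the ambient space is the height. The library relation
  \<open>face_of\<close> admits the empty face, which is excluded here.
\<close>

definition proj_bounded_faces :: "('a::euclidean_space \<times> real) set \<Rightarrow> 'a set set" where
  "proj_bounded_faces S = {fst ` F | F. F face_of S \<and> F \<noteq> {} \<and> bounded F}"

definition cayley_subdivision ::
    "(nat ^ 3 \<Rightarrow> ereal) \<Rightarrow> (nat ^ 3 \<Rightarrow> ereal) \<Rightarrow> ((real ^ 3) \<times> real) set set" where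
  "cayley_subdivision p q =
     proj_bounded_faces (convex hull
       ({((real_vec e, 0), \<alpha>) | e \<alpha>. ereal \<alpha> \<le> p e} \<union>
        {((real_vec e, 1), \<beta>) | e \<beta>. ereal \<beta> \<le> q e}))"

definition smooth_complete_intersection ::
    "(nat ^ 3 \<Rightarrow> ereal) \<Rightarrow> (nat ^ 3 \<Rightarrow> ereal) \<Rightarrow> bool" where
  "smooth_complete_intersection p q \<longleftrightarrow>
     (\<forall>Q \<in> cayley_subdivision p q. aff_dim Q = 4 \<longrightarrow> measure lebesgue Q = 1 / 24)"

text \<open>The polynomial \<open>x \<oplus> y \<oplus> z \<oplus> 0\<close>: four monomials with coefficient \<open>0\<close>.\<close>

definition trop_plane :: "nat ^ 3 \<Rightarrow> ereal" where
  "trop_plane e =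
     (if e \<in> {vector [1,0,0], vector [0,1,0], vector [0,0,1], vector [0,0,0]} then 0 else -\<infinity>)"

definition restrict_z0 :: "nat \<Rightarrow> (nat ^ 3 \<Rightarrow> ereal) \<Rightarrow> nat ^ 2 \<Rightarrow> ereal" where
  "restrict_z0 m g e =
     (if e $ 1 + e $ 2 \<le> m
      then Max ((\<lambda>c. g (vector [e $ 1, e $ 2, c])) ` {0..m - (e $ 1 + e $ 2)})
      else -\<infinity>)"

definition dual_subdivision :: "(nat ^ 2 \<Rightarrow> ereal) \<Rightarrow> (real ^ 2) set set" where
  "dual_subdivision h =
     proj_bounded_faces (convex hull {(real_vec e, \<alpha>) | e \<alpha>. ereal \<alpha> \<le> h e})"

text \<open>
  The cell of the dual complex (vertices and edges of the tropical curve, closures of domains)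
  that corresponds to the cell \<open>Q\<close> of the subdivision.
\<close>

definition dual_cell :: "(nat ^ 2 \<Rightarrow> ereal) \<Rightarrow> (real ^ 2) set \<Rightarrow> (real ^ 2) set" where
  "dual_cell h Q = {t. \<forall>e. real_vec e extreme_point_of Q \<longrightarrow> e \<in> max_terms h t}"

definition marked_complex :: "(nat ^ 2 \<Rightarrow> ereal) \<Rightarrow> (real ^ 2) set set" where
  "marked_complex h =
     {Q \<in> dual_subdivision h. dual_cell h Q \<inter> {t. t $ 1 \<le> 0 \<and> t $ 2 \<le> 0} \<noteq> {}}"

definition marked_vertex_meeting :: "(nat ^ 2 \<Rightarrow> ereal) \<Rightarrow> (real ^ 2) set \<Rightarrow> real ^ 2 \<Rightarrow> bool" where
  "marked_vertex_meeting h A v \<longleftrightarrow>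
     {v} \<in> marked_complex h \<and>
     (\<exists>e D. real_vec e = v \<and> corresponds h D e \<and> D \<inter> A \<noteq> {})"

definition u_vertex :: "(nat ^ 2 \<Rightarrow> ereal) \<Rightarrow> nat \<Rightarrow> int" where
  "u_vertex h i =
     (THE k. marked_vertex_meeting h {t. t $ 1 \<le> 0 \<and> t $ 2 = 0} (vector [real i, of_int k]))"

definition r_vertex :: "(nat ^ 2 \<Rightarrow> ereal) \<Rightarrow> nat \<Rightarrow> int" where
  "r_vertex h j =
     (THE k. marked_vertex_meeting h {t. t $ 1 = 0 \<and> t $ 2 \<le> 0} (vector [of_int k, real j]))"

text \<open>Used on \<open>[0, n]\<close> only; at \<open>s = n\<close> the value \<open>w (n + 1)\<close> has weight \<open>0\<close>.\<close>

definition lin_interp :: "(nat \<Rightarrow> int) \<Rightarrow> real \<Rightarrow> real" where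
  "lin_interp w s =
     (1 - frac s) * of_int (w (nat \<lfloor>s\<rfloor>)) + frac s * of_int (w (nat \<lfloor>s\<rfloor> + 1))"

end

theory Submission
  imports Defs
begin

text \<open>
  Let \<open>H\<close> be the convex piecewise linear function defined by the restriction of \<open>g\<close> to
  \<open>z = 0\<close>. The cells of the dual subdivision are the subdifferentials of \<open>H\<close>, so \<open>|K'|\<close> is
  the union of the subdifferentials at the points of the quadrant of nonpositive coordinates.
  Every \<open>w\<close> with nonnegative coordinates has a minimiser \<open>t\<close> of \<open>H - w\<close> on the quadrant.
  If \<open>t\<close> is an interior point, \<open>w\<close> is a subgradient; if \<open>t\<close> lies on a boundary ray, \<open>w\<close>
  lies on or beyond the graph of \<open>u\<close> or \<open>r\<close>; if \<open>t\<close> is the origin, \<open>w\<close> dominates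
  \<open>(a0, b0)\<close>. Monotonicity of the subdifferential shows that no point strictly beyond these
  bounds is a subgradient.

  Smoothness enters only on the two boundary rays and at the origin. There the tropical plane
  has at least three maximal terms, so a point where \<open>g\<close> has several maximal terms yields a
  Cayley cell containing an explicit simplex. Comparing volumes, the cell is this simplex: at
  the origin only one term of \<open>g\<close> is maximal, and on a ray at most two are, with exponents
  differing by one in the direction of the ray. Hence \<open>u\<close> and \<open>r\<close> interpolate
  consecutive vertices of \<open>K'\<close>.
\<close>

subsection \<open>Maxima of finitely many affine functions\<close>

text \<open>The set \<open>?C\<close> is convex because a face that meets an open segment of the
  hull contains both its ends. \<open>G\<close> may be infinite and unbounded, as for the downward
  rays in \<open>hypograph\<close>.\<close>

lemma face_of_hull_subset_hull_Int:
  fixes G :: "'a::real_vector set"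
  assumes T: "T face_of convex hull G"
  shows "T \<subseteq> convex hull (T \<inter> G)"
proof -
  let ?C = "{x \<in> convex hull G. x \<in> T \<longrightarrow> x \<in> convex hull (T \<inter> G)}"
  have open_segment_C: "z \<in> ?C"
    if x: "x \<in> ?C" and y: "y \<in> ?C" and z: "z \<in> open_segment x y" for x y z
  proof -
    have zG: "z \<in> convex hull G"
      using x y z convex_contains_open_segment[of "convex hull G"] by blast
    have "z \<in> convex hull (T \<inter> G)" if "z \<in> T"
    proof -
      have "x \<in> T" "y \<in> T"
        using T x y z that unfolding face_of_def by blast+
      then have "x \<in> convex hull (T \<inter> G)" "y \<in> convex hull (T \<inter> G)"
        using x y by auto
      then show ?thesis
        using z convex_contains_open_segment[of "convex hull (T \<inter> G)"] by blast
    qed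
    then show ?thesis using zG by blast
  qed
  then have "convex ?C" unfolding convex_contains_open_segment by blast
  moreover have "G \<subseteq> ?C" by (auto intro: hull_inc)
  ultimately have "convex hull G \<subseteq> ?C" by (rule hull_minimal[rotated])
  then show ?thesis using face_of_imp_subset[OF T] by blast
qed

lemma face_of_hull_eq_hull_Int:
  assumes T: "T face_of convex hull G"
  shows "T = convex hull (T \<inter> G)"
proof
  show "convex hull (T \<inter> G) \<subseteq> T"
    by (rule hull_minimal) (auto intro: face_of_imp_convex[OF T])
qed (rule face_of_hull_subset_hull_Int[OF T])

lemma hull_Int_supporting_hyperplane:
  fixes G :: "'a::real_inner set"
  assumes "\<And>x. x \<in> G \<Longrightarrow> a \<bullet> x \<le> b"
  shows "convex hull G \<inter> {x. a \<bullet> x = b} = convex hull (G \<inter> {x. a \<bullet> x = b})"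
    and "(convex hull G \<inter> {x. a \<bullet> x = b}) face_of convex hull G"
proof -
  have "convex hull G \<subseteq> {x. a \<bullet> x \<le> b}"
    using assms by (intro hull_minimal) (auto simp: convex_halfspace_le)
  then show F: "(convex hull G \<inter> {x. a \<bullet> x = b}) face_of convex hull G"
    by (intro face_of_Int_supporting_hyperplane_le) auto
  have "convex hull G \<inter> {x. a \<bullet> x = b} \<inter> G = G \<inter> {x. a \<bullet> x = b}"
    using hull_subset[of G convex] by blast
  then show "convex hull G \<inter> {x. a \<bullet> x = b} = convex hull (G \<inter> {x. a \<bullet> x = b})"
    using face_of_hull_eq_hull_Int[OF F] by simp
qed

section \<open>Subdifferentials of a maximum of affine functions\<close>

locale max_affine =
  fixes I :: "'i set" and v :: "'i \<Rightarrow> 'a::euclidean_space" and c :: "'i \<Rightarrow> real"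
  assumes finite_I: "finite I" and nonempty_I: "I \<noteq> {}"
begin

definition H :: "'a \<Rightarrow> real" where
  "H t = Max ((\<lambda>i. c i + v i \<bullet> t) ` I)"

definition active :: "'a \<Rightarrow> 'i set" where
  "active t = {i \<in> I. c i + v i \<bullet> t = H t}"

text \<open>The subdifferential of \<open>H\<close> at \<open>t\<close>: \<open>subgradsD\<close>
  gives one inclusion and \<open>subgradsI\<close> the other.\<close>

definition subgrads :: "'a \<Rightarrow> 'a set" where
  "subgrads t = convex hull (v ` active t)"

lemma H_ge: "i \<in> I \<Longrightarrow> c i + v i \<bullet> t \<le> H t"
  unfolding H_def using finite_I by (intro Max_ge) auto

lemma H_le: "(\<And>i. i \<in> I \<Longrightarrow> c i + v i \<bullet> t \<le> x) \<Longrightarrow> H t \<le> x"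
  unfolding H_def using finite_I nonempty_I by (intro Max.boundedI) auto

lemma active_nonempty: "active t \<noteq> {}"
proof -
  have "H t \<in> (\<lambda>i. c i + v i \<bullet> t) ` I"
    unfolding H_def using finite_I nonempty_I by (intro Max_in) auto
  then show ?thesis by (auto simp: active_def)
qed

lemma finite_active: "finite (active t)"
  using finite_I by (simp add: active_def)

lemma active_subset: "active t \<subseteq> I"
  by (auto simp: active_def)

lemma H_active: "i \<in> active t \<Longrightarrow> H t = c i + v i \<bullet> t"
  by (simp add: active_def)

lemma active_iff: "active t = {i \<in> I. \<forall>j\<in>I. c j + v j \<bullet> t \<le> c i + v i \<bullet> t}"
proof -
  have "c i + v i \<bullet> t = H t \<longleftrightarrow> (\<forall>j\<in>I. c j + v j \<bullet> t \<le> c i + v i \<bullet> t)"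
    if "i \<in> I" for i
    using H_ge H_le[of t] that by (metis antisym)
  then show ?thesis by (auto simp: active_def)
qed

lemma active_subgrads: "i \<in> active t \<Longrightarrow> v i \<in> subgrads t"
  by (auto simp: subgrads_def intro: hull_inc)

lemma subgradsD:
  assumes "w \<in> subgrads t"
  shows "H t + w \<bullet> (s - t) \<le> H s"
proof -
  have "v ` active t \<subseteq> {w. (s - t) \<bullet> w \<le> H s - H t}"
  proof clarify
    fix i assume "i \<in> active t"
    then have "H t = c i + v i \<bullet> t" "i \<in> I" by (auto simp: active_def)
    then show "(s - t) \<bullet> v i \<le> H s - H t"
      using H_ge[of i s] by (simp add: inner_diff_left inner_diff_right inner_commute)
  qed
  then have "subgrads t \<subseteq> {w. (s - t) \<bullet> w \<le> H s - H t}"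
    unfolding subgrads_def by (rule hull_minimal) (rule convex_halfspace_le)
  then show ?thesis using assms by (auto simp: inner_commute)
qed

lemma subgrads_monotone:
  assumes "w \<in> subgrads t" "p \<in> subgrads s"
  shows "0 \<le> (w - p) \<bullet> (t - s)"
  using subgradsD[OF assms(1), of s] subgradsD[OF assms(2), of t]
  by (simp add: inner_diff_left inner_diff_right)

text \<open>A term below the maximum at \<open>t\<close> stays strictly below a fixed active term
  near \<open>t\<close>; as there are finitely many terms, one neighbourhood serves all.\<close>

lemma eventually_active_subset: "\<forall>\<^sub>F s in nhds t. active s \<subseteq> active t"
proof -
  obtain i where i: "i \<in> active t" using active_nonempty by blast
  have "\<forall>\<^sub>F s in nhds t. j \<notin> active s" if j: "j \<in> I - active t" for j
  proof -
    have lt: "c j + v j \<bullet> t < c i + v i \<bullet> t"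
      using i j H_ge[of j t] by (auto simp: active_def less_le)
    have "open {s. c j + v j \<bullet> s < c i + v i \<bullet> s}"
      by (intro open_Collect_less continuous_intros)
    then have "\<forall>\<^sub>F s in nhds t. c j + v j \<bullet> s < c i + v i \<bullet> s"
      using lt by (auto dest: eventually_nhds_in_open[of _ t])
    then show ?thesis
    proof (rule eventually_mono)
      fix s assume "c j + v j \<bullet> s < c i + v i \<bullet> s"
      then show "j \<notin> active s"
        using H_ge[of i s] i by (auto simp: active_def)
    qed
  qed
  then have "\<forall>\<^sub>F s in nhds t. \<forall>j \<in> I - active t. j \<notin> active s"
    using finite_I by (simp add: eventually_ball_finite)
  then show ?thesis
    by (rule eventually_mono) (auto simp: active_def)
qed

lemma eventually_active_subset_dir:
  "\<forall>\<^sub>F \<delta> in at_right 0. active (t + \<delta> *\<^sub>R d) \<subseteq> active t"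
proof -
  have "((\<lambda>\<delta>::real. t + \<delta> *\<^sub>R d) \<longlongrightarrow> t + 0 *\<^sub>R d) (at_right 0)"
    by (intro tendsto_intros)
  then have "filterlim (\<lambda>\<delta>::real. t + \<delta> *\<^sub>R d) (nhds t) (at_right 0)" by simp
  then show ?thesis
    using eventually_active_subset[of t] unfolding filterlim_iff by blast
qed

text \<open>Terms active at \<open>t\<close> start from the same value, so after a step only those
  of largest slope in direction \<open>d\<close> can lead.\<close>

lemma active_dir_maximal:
  assumes sub: "active (t + \<delta> *\<^sub>R d) \<subseteq> active t" and pos: "\<delta> > 0"
    and i: "i \<in> active (t + \<delta> *\<^sub>R d)" and j: "j \<in> active t"
  shows "v j \<bullet> d \<le> v i \<bullet> d"
proof -
  have it: "i \<in> active t" using sub i by blast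
  have "c j + v j \<bullet> (t + \<delta> *\<^sub>R d) \<le> c i + v i \<bullet> (t + \<delta> *\<^sub>R d)"
    using i j H_ge[of j] by (auto simp: active_def)
  moreover have "c j + v j \<bullet> t = c i + v i \<bullet> t"
    using it j by (auto simp: active_def)
  ultimately have "\<delta> * (v j \<bullet> d) \<le> \<delta> * (v i \<bullet> d)"
    by (simp add: inner_add_right)
  then show ?thesis using pos by simp
qed

text \<open>The directional derivative of \<open>H\<close> is the slope of a term active both at
  \<open>t\<close> and just after it. Only small positive steps are tested, which suits feasible
  directions at a boundary point.\<close>

lemma active_direction:
  assumes "\<forall>\<^sub>F \<delta> in at_right 0. H t + \<delta> * (w \<bullet> d) \<le> H (t + \<delta> *\<^sub>R d)"
  obtains i where "i \<in> active t" "w \<bullet> d \<le> v i \<bullet> d"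
proof -
  have "\<forall>\<^sub>F \<delta> in at_right (0::real). \<delta> > 0 \<and> H t + \<delta> * (w \<bullet> d) \<le> H (t + \<delta> *\<^sub>R d) \<and>
      active (t + \<delta> *\<^sub>R d) \<subseteq> active t"
    using assms eventually_active_subset_dir[of t d] eventually_at_right_less[of "0::real"]
    by eventually_elim auto
  then obtain \<delta> :: real where \<delta>: "\<delta> > 0" "H t + \<delta> * (w \<bullet> d) \<le> H (t + \<delta> *\<^sub>R d)"
      "active (t + \<delta> *\<^sub>R d) \<subseteq> active t"
    using eventually_happens'[OF trivial_limit_at_right_real] by blast
  obtain i where i: "i \<in> active (t + \<delta> *\<^sub>R d)" using active_nonempty by blast
  then have it: "i \<in> active t" using \<delta> by blast
  have "H (t + \<delta> *\<^sub>R d) = H t + \<delta> * (v i \<bullet> d)"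
    using H_active[OF i] H_active[OF it] by (simp add: inner_add_right)
  then have "w \<bullet> d \<le> v i \<bullet> d" using \<delta> by simp
  then show ?thesis using it that by blast
qed

lemma convex_subgrads: "convex (subgrads t)"
  by (simp add: subgrads_def)

lemma compact_subgrads: "compact (subgrads t)"
  unfolding subgrads_def using finite_active by (intro finite_imp_compact_convex_hull) auto

text \<open>If \<open>w\<close> lay outside the compact convex set \<open>subgrads t\<close>, the
  growth bound along a separating direction would give an active term on the wrong side.\<close>

lemma subgradsI:
  assumes "\<And>d. \<forall>\<^sub>F \<delta> in at_right 0. H t + \<delta> * (w \<bullet> d) \<le> H (t + \<delta> *\<^sub>R d)"
  shows "w \<in> subgrads t"
proof (rule ccontr)
  assume "w \<notin> subgrads t"
  then obtain a b where ab: "a \<bullet> w < b" "\<forall>x\<in>subgrads t. b < a \<bullet> x"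
    using separating_hyperplane_closed_point[OF convex_subgrads compact_imp_closed[OF compact_subgrads]]
    by blast
  obtain i where "i \<in> active t" "w \<bullet> (- a) \<le> v i \<bullet> (- a)"
    using active_direction[OF assms[of "- a"]] by blast
  then show False using ab active_subgrads[of i t] by (fastforce simp: inner_commute)
qed

text \<open>
  Linear programming duality: the largest \<open>\<alpha>\<close> for which \<open>(w, \<alpha>, 1)\<close> lies in the cone
  generated by the points \<open>(v i, c i, 1)\<close> and \<open>(b, 0, 0)\<close> is the minimum, and a facet of the
  cone that bounds \<open>\<alpha>\<close> from above yields the minimiser.
\<close>

lemma minimiser_exists:
  assumes B: "finite B" and i0: "i0 \<in> I" and w: "w - v i0 \<in> convex_cone hull B"
  obtains t where "\<forall>b\<in>B. t \<bullet> b \<le> 0"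
    "\<And>s. \<forall>b\<in>B. s \<bullet> b \<le> 0 \<Longrightarrow> H t - w \<bullet> t \<le> H s - w \<bullet> s"
proof -
  define G :: "('a \<times> real \<times> real) set" where
    "G = (\<lambda>i. (v i, c i, 1)) ` I \<union> (\<lambda>b. (b, 0, 0)) ` B"
  define K where "K = convex_cone hull G"
  have finG: "finite G" unfolding G_def using B finite_I by simp
  have cone: "convex_cone K" unfolding K_def by (rule convex_cone_convex_cone_hull)
  have poly: "polyhedron K" unfolding K_def using finG by (rule polyhedron_convex_cone_hull)
  have GK: "g \<in> K" if "g \<in> G" for g unfolding K_def using that by (rule hull_inc)
  \<comment> \<open>Weak duality: for feasible \<open>s\<close> the functional
    \<open>(s, 1, - H s)\<close> is nonpositive on the generators, hence on the cone.\<close>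
  have weak: "\<alpha> + w \<bullet> s \<le> H s" if "(w, \<alpha>, 1) \<in> K" and s: "\<forall>b\<in>B. s \<bullet> b \<le> 0" for \<alpha> s
  proof -
    have "K \<subseteq> {x. (s, 1, - H s) \<bullet> x \<le> 0}"
      unfolding K_def
    proof (rule hull_minimal)
      show "G \<subseteq> {x. (s, 1, - H s) \<bullet> x \<le> 0}"
        unfolding G_def using s H_ge[of _ s] by (auto simp: inner_commute algebra_simps)
    qed (rule convex_cone_halfspace_le)
    then show ?thesis using that by (auto simp: inner_commute)
  qed
  define A where "A = {\<alpha>. (w, \<alpha>, 1::real) \<in> K}"
  have feas: "c i0 \<in> A"
  proof -
    have "convex_cone hull B \<subseteq> {x. (x, 0, 0) \<in> K}"
    proof (rule hull_minimal)
      show "B \<subseteq> {x. (x, 0, 0) \<in> K}" using GK by (auto simp: G_def)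
      show "convex_cone {x. (x, 0, 0) \<in> K}"
        unfolding convex_cone_iff
      proof (intro conjI ballI allI impI)
        show "0 \<in> {x. (x, 0, 0) \<in> K}"
          using convex_cone_contains_0[OF cone] by (simp add: zero_prod_def)
      next
        fix x y assume "x \<in> {x. (x, 0, 0) \<in> K}" "y \<in> {x. (x, 0, 0) \<in> K}"
        then show "x + y \<in> {x. (x, 0, 0) \<in> K}"
          using convex_cone_add[OF cone, of "(x, 0, 0)" "(y, 0, 0)"] by simp
      next
        fix x and r :: real assume "x \<in> {x. (x, 0, 0) \<in> K}" "0 \<le> r"
        then show "r *\<^sub>R x \<in> {x. (x, 0, 0) \<in> K}"
          using convex_cone_scaleR[OF cone, of r "(x, 0, 0)"] by simp
      qed
    qed
    then have "(w - v i0, 0, 0) \<in> K" using w by blast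
    moreover have "(v i0, c i0, 1) \<in> K" using GK i0 by (auto simp: G_def)
    ultimately have "(w - v i0, 0, 0) + (v i0, c i0, 1) \<in> K"
      by (rule convex_cone_add[OF cone])
    then show ?thesis by (simp add: A_def)
  qed
  have bdd: "bdd_above A"
    using weak[of _ 0] by (auto simp: A_def bdd_above_def)
  have "closed A"
  proof -
    have "closed ((\<lambda>\<alpha>::real. (w, \<alpha>, 1::real)) -` K)"
      by (intro closed_vimage polyhedron_imp_closed[OF poly] continuous_intros)
    then show ?thesis by (simp add: A_def vimage_def)
  qed
  define \<alpha> where "\<alpha> = Sup A"
  have \<alpha>A: "\<alpha> \<in> A"
    unfolding \<alpha>_def using feas bdd \<open>closed A\<close> by (intro closed_contains_Sup) auto
  have \<alpha>max: "\<beta> \<notin> A" if "\<beta> > \<alpha>" for \<beta>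
    using that cSup_upper[OF _ bdd, of \<beta>] unfolding \<alpha>_def by fastforce
  obtain F where F: "finite F" "K = \<Inter>F" "\<forall>h\<in>F. \<exists>a b. a \<noteq> 0 \<and> h = {x. a \<bullet> x \<le> b}"
    using poly unfolding polyhedron_def by blast
  \<comment> \<open>\<open>\<alpha>\<close> cannot grow, and there are finitely many half-spaces, so
    one of them cuts off points above \<open>\<alpha>\<close> arbitrarily close to it.\<close>
  have "\<exists>h\<in>F. \<not> (\<forall>\<^sub>F \<delta> in at_right (0::real). (w, \<alpha> + \<delta>, 1) \<in> h)"
  proof (rule ccontr)
    assume "\<not> ?thesis"
    then have "\<forall>\<^sub>F \<delta> in at_right (0::real). \<forall>h\<in>F. (w, \<alpha> + \<delta>, 1) \<in> h"
      using F(1) by (simp add: eventually_ball_finite)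
    then have "\<forall>\<^sub>F \<delta> in at_right (0::real). \<delta> > 0 \<and> \<alpha> + \<delta> \<in> A"
      using eventually_at_right_less[of "0::real"] by eventually_elim (auto simp: A_def F(2))
    then obtain \<delta> :: real where "\<delta> > 0" "\<alpha> + \<delta> \<in> A"
      using eventually_happens'[OF trivial_limit_at_right_real] by blast
    then show False using \<alpha>max[of "\<alpha> + \<delta>"] by simp
  qed
  then obtain h where h: "h \<in> F" "\<not> (\<forall>\<^sub>F \<delta> in at_right (0::real). (w, \<alpha> + \<delta>, 1) \<in> h)" by blast
  obtain y \<sigma> \<rho> b where hab: "h = {x. (y, \<sigma>, \<rho>) \<bullet> x \<le> b}"
    using F(3) h(1) by (metis prod_cases3)
  have Kh: "K \<subseteq> h" using F(2) h(1) by blast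
  let ?p = "(w, \<alpha>, 1::real)"
  have pK: "?p \<in> K" using \<alpha>A by (simp add: A_def)
  have b0: "0 \<le> b"
    using Kh cone convex_cone_contains_0[OF cone] by (auto simp: hab)
  have eqb: "(y, \<sigma>, \<rho>) \<bullet> ?p = b"
  proof (rule ccontr)
    assume "(y, \<sigma>, \<rho>) \<bullet> ?p \<noteq> b"
    then have lt: "(y, \<sigma>, \<rho>) \<bullet> ?p < b" using Kh pK by (auto simp: hab less_le)
    have "((\<lambda>\<delta>. (y, \<sigma>, \<rho>) \<bullet> (w, \<alpha> + \<delta>, 1)) \<longlongrightarrow> (y, \<sigma>, \<rho>) \<bullet> (w, \<alpha> + 0, 1)) (at_right 0)"
      by (intro tendsto_intros)
    then have "\<forall>\<^sub>F \<delta> in at_right (0::real). (y, \<sigma>, \<rho>) \<bullet> (w, \<alpha> + \<delta>, 1) < b"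
      using lt by (intro order_tendstoD) auto
    then have "\<forall>\<^sub>F \<delta> in at_right (0::real). (w, \<alpha> + \<delta>, 1) \<in> h"
      unfolding hab mem_Collect_eq by (rule eventually_mono) (rule less_imp_le)
    then show False using h(2) by blast
  qed
  have \<sigma>: "\<sigma> > 0"
  proof (rule ccontr)
    assume "\<not> \<sigma> > 0"
    have "\<forall>\<^sub>F \<delta> in at_right (0::real). (w, \<alpha> + \<delta>, 1) \<in> h"
      using eventually_at_right_less[of "0::real"]
    proof eventually_elim
      case (elim \<delta>)
      then have "\<sigma> * \<delta> \<le> 0" using \<open>\<not> \<sigma> > 0\<close> by (simp add: mult_nonpos_nonneg)
      then show ?case using eqb by (simp add: hab algebra_simps)
    qed
    then show False using h(2) by blast
  qed
  have scale: "r *\<^sub>R x \<in> K" if "x \<in> K" "r \<ge> 0" for x r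
    using convex_cone_scaleR[OF cone] that by blast
  \<comment> \<open>Doubling a point of the cone on the boundary of \<open>h\<close> stays in
    \<open>h\<close>, that is, \<open>2 * b \<le> b\<close>.\<close>
  have "b \<le> 0"
  proof -
    have "(2::real) *\<^sub>R ?p \<in> h" using scale[OF pK, of 2] Kh by auto
    then show ?thesis using eqb by (simp add: hab algebra_simps)
  qed
  then have "b = 0" using b0 by simp
  \<comment> \<open>The facet normal, scaled to height coefficient 1. Its signs on the generators
    from \<open>B\<close> are the constraints on \<open>t\<close>; on those from \<open>I\<close>
    they bound \<open>H t\<close>.\<close>
  define t where "t = (1 / \<sigma>) *\<^sub>R y"
  have gle: "(y, \<sigma>, \<rho>) \<bullet> g \<le> 0" if "g \<in> G" for g
    using GK[OF that] Kh \<open>b = 0\<close> by (auto simp: hab)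
  have tB: "\<forall>b\<in>B. t \<bullet> b \<le> 0"
  proof
    fix b assume "b \<in> B"
    then have "y \<bullet> b \<le> 0" using gle[of "(b, 0, 0)"] by (auto simp: G_def)
    then show "t \<bullet> b \<le> 0" using \<sigma> by (simp add: t_def divide_nonpos_pos)
  qed
  have "H t \<le> \<alpha> + w \<bullet> t"
  proof (rule H_le)
    fix i assume "i \<in> I"
    then have "y \<bullet> v i + \<sigma> * c i + \<rho> \<le> y \<bullet> w + \<sigma> * \<alpha> + \<rho>"
      using gle[of "(v i, c i, 1)"] eqb \<open>b = 0\<close> by (auto simp: G_def)
    then have "\<sigma> * c i + y \<bullet> v i \<le> \<sigma> * \<alpha> + y \<bullet> w" by simp
    then have "(\<sigma> * c i + y \<bullet> v i) / \<sigma> \<le> (\<sigma> * \<alpha> + y \<bullet> w) / \<sigma>"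
      using \<sigma> by (intro divide_right_mono) auto
    then show "c i + v i \<bullet> t \<le> \<alpha> + w \<bullet> t"
      using \<sigma> by (simp add: t_def add_divide_distrib inner_commute)
  qed
  then have "H t - w \<bullet> t \<le> H s - w \<bullet> s" if "\<forall>b\<in>B. s \<bullet> b \<le> 0" for s
    using weak[OF pK that] by simp
  then show ?thesis using that tB by blast
qed

section \<open>Cells of the dual subdivision\<close>

definition hypograph :: "('a \<times> real) set" where
  "hypograph = convex hull {(v i, \<alpha>) | i \<alpha>. i \<in> I \<and> \<alpha> \<le> c i}"

text \<open>The functional \<open>(t, 1)\<close> is bounded by \<open>H t\<close> on the hypograph,
  and the generators attaining this bound are the lifted active terms; the face so cut out projects
  onto \<open>subgrads t\<close>.\<close>

lemma subgrads_cell: "subgrads t \<in> proj_bounded_faces hypograph"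
proof -
  let ?G = "{(v i, \<alpha>) | i \<alpha>. i \<in> I \<and> \<alpha> \<le> c i}" and ?P = "{x. (t, 1::real) \<bullet> x = H t}"
  have le: "(t, 1) \<bullet> x \<le> H t" if x: "x \<in> ?G" for x
  proof -
    obtain i \<alpha> where "x = (v i, \<alpha>)" "i \<in> I" "\<alpha> \<le> c i" using x by blast
    then show ?thesis using H_ge[of i t] by (simp add: inner_commute)
  qed
  have eq: "?G \<inter> ?P = (\<lambda>i. (v i, c i)) ` active t"
  proof (intro equalityI subsetI)
    fix x assume "x \<in> ?G \<inter> ?P"
    then obtain i \<alpha> where i: "x = (v i, \<alpha>)" "i \<in> I" "\<alpha> \<le> c i" "t \<bullet> v i + \<alpha> = H t" by auto
    then have "\<alpha> = c i" using H_ge[of i t] by (simp add: inner_commute)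
    then show "x \<in> (\<lambda>i. (v i, c i)) ` active t"
      using i by (auto simp: active_def inner_commute)
  next
    fix x assume "x \<in> (\<lambda>i. (v i, c i)) ` active t"
    then show "x \<in> ?G \<inter> ?P" by (auto simp: active_def inner_commute)
  qed
  have F: "convex hull ?G \<inter> ?P = convex hull ((\<lambda>i. (v i, c i)) ` active t)"
    "(convex hull ?G \<inter> ?P) face_of convex hull ?G"
    using hull_Int_supporting_hyperplane[of ?G "(t, 1)" "H t"] le eq by auto
  have "fst ` (convex hull ((\<lambda>i. (v i, c i)) ` active t)) = subgrads t"
    unfolding subgrads_def
    by (simp add: convex_hull_linear_image[OF linear_fst] image_image)
  moreover have "bounded (convex hull ((\<lambda>i. (v i, c i)) ` active t))"
    using finite_active by (intro finite_imp_bounded_convex_hull) auto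
  moreover have "convex hull ((\<lambda>i. (v i, c i)) ` active t) \<noteq> {}"
    using active_nonempty by simp
  ultimately show ?thesis
    unfolding proj_bounded_faces_def hypograph_def using F by (intro CollectI exI) auto
qed

text \<open>A face is the hull of the generators in it, and a bounded one contains only generators
  at full height \<open>c i\<close>. Cells are thus polytopes, determined by their extreme
  points.\<close>

lemma cell_hull:
  assumes "Q \<in> proj_bounded_faces hypograph"
  obtains J where "J \<subseteq> I" "Q = convex hull (v ` J)"
proof -
  let ?G = "{(v i, \<alpha>) | i \<alpha>. i \<in> I \<and> \<alpha> \<le> c i}"
  obtain F where F: "F face_of convex hull ?G" "bounded F" "Q = fst ` F"
    using assms unfolding proj_bounded_faces_def hypograph_def by blast
  \<comment> \<open>a face point below the graph would put a whole downward ray into the face\<close>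
  have top: "\<alpha> = c i" if i: "i \<in> I" "\<alpha> \<le> c i" and inF: "(v i, \<alpha>) \<in> F" for i \<alpha>
  proof (rule ccontr)
    assume "\<alpha> \<noteq> c i"
    then have lt: "\<alpha> < c i" using i by simp
    have below: "(v i, \<beta>) \<in> F" if "\<beta> < \<alpha>" for \<beta>
    proof -
      define u where "u = (c i - \<alpha>) / (c i - \<beta>)"
      have e: "u * (c i - \<beta>) = c i - \<alpha>" and u: "0 < u" "u < 1"
        using that lt by (simp_all add: u_def)
      have "(1 - u) * c i + u * \<beta> = c i - u * (c i - \<beta>)"
        by (simp only: left_diff_distrib right_diff_distrib mult_1)
      then have "(1 - u) * c i + u * \<beta> = \<alpha>"
        unfolding e by simp
      then have "(v i, \<alpha>) = (1 - u) *\<^sub>R (v i, c i) + u *\<^sub>R (v i, \<beta>)"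
        by (simp add: scaleR_left_diff_distrib)
      then have "(v i, \<alpha>) \<in> open_segment (v i, c i) (v i, \<beta>)"
        using u that lt unfolding in_segment by auto
      moreover have "(v i, c i) \<in> convex hull ?G" "(v i, \<beta>) \<in> convex hull ?G"
        using i that lt
        by (auto intro!: hull_inc exI[of _ i] simp: less_imp_le less_trans[THEN less_imp_le])
      ultimately show ?thesis using F(1) inF unfolding face_of_def by blast
    qed
    obtain K where K: "\<And>x. x \<in> F \<Longrightarrow> norm x \<le> K"
      using F(2) unfolding bounded_iff by blast
    \<comment> \<open>Below \<open>\<alpha>\<close>, and with absolute value above
      \<open>K\<close>.\<close>
    define \<beta> where "\<beta> = min (\<alpha> - 1) (- K - 1)"
    have "norm (v i, \<beta>) \<le> K" using below[of \<beta>] K by (simp add: \<beta>_def)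
    then have "\<bar>\<beta>\<bar> \<le> K" using norm_snd_le[of \<beta> "v i"] by simp
    then show False by (auto simp: \<beta>_def min_def split: if_splits)
  qed
  define J where "J = {i \<in> I. (v i, c i) \<in> F}"
  have "F \<inter> ?G = (\<lambda>i. (v i, c i)) ` J"
    using top by (force simp: J_def)
  then have "F = convex hull ((\<lambda>i. (v i, c i)) ` J)"
    using face_of_hull_eq_hull_Int[OF F(1)] by simp
  then have "Q = convex hull (v ` J)"
    by (simp add: F(3) convex_hull_linear_image[OF linear_fst] image_image)
  then show ?thesis using that[of J] by (auto simp: J_def)
qed

end

subsection \<open>Volumes of Cayley simplices\<close>

lemma emeasure_lborel_compact:
  "compact S \<Longrightarrow> emeasure lborel S = ennreal (measure lebesgue S)"
  using emeasure_compact_finite[of S]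
  by (simp add: emeasure_eq_ennreal_measure less_top compact_imp_closed borel_closed)

lemma compact_vimage_Pair:
  fixes S :: "('a::euclidean_space \<times> 'b::euclidean_space) set"
  assumes "compact S"
  shows "compact ((\<lambda>x. (x, y)) -` S)" "compact (Pair x -` S)"
proof -
  have "closed ((\<lambda>x. (x, y)) -` S)" "closed (Pair x -` S)"
    using compact_imp_closed[OF assms] by (intro closed_vimage continuous_intros; assumption)+
  moreover have "(\<lambda>x. (x, y)) -` S \<subseteq> fst ` S" "Pair x -` S \<subseteq> snd ` S"
    by force+
  then have "bounded ((\<lambda>x. (x, y)) -` S)" "bounded (Pair x -` S)"
    using bounded_fst bounded_snd compact_imp_bounded[OF assms] bounded_subset by metis+
  ultimately show "compact ((\<lambda>x. (x, y)) -` S)" "compact (Pair x -` S)"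
    by (simp_all add: compact_eq_bounded_closed)
qed

lemma lborel_pair_sets:
  fixes S :: "('a::euclidean_space \<times> 'b::euclidean_space) set"
  assumes "compact S"
  shows "S \<in> sets (lborel \<Otimes>\<^sub>M lborel)"
  using assms by (simp only: lborel_prod) (simp add: compact_imp_closed borel_closed)

text \<open>Fubini over the last coordinate: the slice at height \<open>s\<close> is mapped by
  \<open>A\<close> and translated by \<open>s *\<^sub>R b\<close>, so a determinant is taken only on
  the slices.\<close>

lemma measure_horizontal_shear:
  fixes A :: "real ^ 'n::{finite,wellorder} \<Rightarrow> real ^ 'n::_" and b :: "real ^ 'n::_" and S :: "((real ^ 'n::_) \<times> real) set"
  assumes A: "linear A" and S: "compact S"
  defines "T \<equiv> \<lambda>(x, s). (A x + s *\<^sub>R b, s)"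
  shows "measure lebesgue (T ` S) = \<bar>det (matrix A)\<bar> * measure lebesgue S"
proof -
  have "continuous_on UNIV A" using A by (simp add: linear_continuous_on linear_linear)
  then have "continuous_on UNIV T"
    unfolding T_def case_prod_beta
    by (auto intro!: continuous_intros intro: continuous_on_compose2)
  then have TS: "compact (T ` S)" using S by (auto intro: compact_continuous_image continuous_on_subset)
  have slice: "emeasure lborel ((\<lambda>x. (x, s)) -` (T ` S)) =
      ennreal \<bar>det (matrix A)\<bar> * emeasure lborel ((\<lambda>x. (x, s)) -` S)" for s
  proof -
    let ?K = "(\<lambda>x. (x, s)) -` S"
    have K: "compact ?K" by (rule compact_vimage_Pair[OF S])
    have "(\<lambda>x. (x, s)) -` (T ` S) = (+) (s *\<^sub>R b) ` (A ` ?K)"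
      by (force simp: T_def image_iff add.commute)
    then have "measure lebesgue ((\<lambda>x. (x, s)) -` (T ` S)) = \<bar>det (matrix A)\<bar> * measure lebesgue ?K"
      using measure_linear_image[OF A lmeasurable_compact[OF K]] by (simp add: measure_translation)
    then show ?thesis
      by (simp add: emeasure_lborel_compact[OF K]
          emeasure_lborel_compact[OF compact_vimage_Pair(1)[OF TS]] ennreal_mult)
  qed
  have "emeasure (lborel \<Otimes>\<^sub>M lborel) (T ` S) =
      (\<integral>\<^sup>+ s. ennreal \<bar>det (matrix A)\<bar> * emeasure lborel ((\<lambda>x. (x, s)) -` S) \<partial>lborel)"
    by (simp add: lborel_pair.emeasure_pair_measure_alt2[OF lborel_pair_sets[OF TS]] slice)
  also have "\<dots> = ennreal \<bar>det (matrix A)\<bar> * (\<integral>\<^sup>+ s. emeasure lborel ((\<lambda>x. (x, s)) -` S) \<partial>lborel)"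
    by (rule nn_integral_cmult) (rule lborel_pair.measurable_emeasure_Pair2[OF lborel_pair_sets[OF S]])
  also have "\<dots> = ennreal \<bar>det (matrix A)\<bar> * emeasure (lborel \<Otimes>\<^sub>M lborel) S"
    by (simp add: lborel_pair.emeasure_pair_measure_alt2[OF lborel_pair_sets[OF S]])
  finally have "ennreal (measure lebesgue (T ` S)) = ennreal (\<bar>det (matrix A)\<bar> * measure lebesgue S)"
    by (simp add: lborel_prod emeasure_lborel_compact S TS ennreal_mult)
  then show ?thesis by (subst (asm) ennreal_inj) auto
qed

text \<open>Fubini in the other order: the fibre over \<open>x\<close> is only translated, by
  \<open>a \<bullet> x\<close>.\<close>

lemma measure_vertical_shear:
  fixes a :: "'a::euclidean_space" and S :: "('a \<times> real) set"
  assumes S: "compact S"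
  defines "T \<equiv> \<lambda>(x, s). (x, s + a \<bullet> x)"
  shows "measure lebesgue (T ` S) = measure lebesgue S"
proof -
  have "continuous_on UNIV T"
    unfolding T_def case_prod_beta by (intro continuous_intros)
  then have TS: "compact (T ` S)" using S by (auto intro: compact_continuous_image continuous_on_subset)
  have slice: "emeasure lborel (Pair x -` (T ` S)) = emeasure lborel (Pair x -` S)" for x
  proof -
    have "Pair x -` (T ` S) = (+) (a \<bullet> x) ` (Pair x -` S)"
      by (force simp: T_def image_iff add.commute)
    then have "measure lebesgue (Pair x -` (T ` S)) = measure lebesgue (Pair x -` S)"
      by (simp add: measure_translation)
    then show ?thesis
      by (simp add: emeasure_lborel_compact compact_vimage_Pair S TS)
  qed
  have "emeasure (lborel \<Otimes>\<^sub>M lborel) (T ` S) = emeasure (lborel \<Otimes>\<^sub>M lborel) S"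
    by (simp add: lborel.emeasure_pair_measure_alt[OF lborel_pair_sets[OF TS]] slice
        lborel.emeasure_pair_measure_alt[OF lborel_pair_sets[OF S]])
  then have "ennreal (measure lebesgue (T ` S)) = ennreal (measure lebesgue S)"
    by (simp add: lborel_prod emeasure_lborel_compact S TS)
  then show ?thesis by (subst (asm) ennreal_inj) auto
qed

lemma Basis_vec_prod_real:
  "(Basis :: ((real ^ 'n) \<times> real) set) = insert (0, 1) (range (\<lambda>i. (axis i 1, 0)))"
  by (auto simp: Basis_prod_def Basis_vec_def)

lemma compact_std_simplex: "compact (convex hull (insert 0 Basis :: 'a::euclidean_space set))"
  by (intro finite_imp_compact_convex_hull) simp

lemma measure_std_simplex_vec3:
  "measure lebesgue (convex hull (insert 0 Basis :: ((real ^ 3) \<times> real) set)) = 1 / 24"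
proof -
  have "measure lebesgue (convex hull (insert 0 Basis :: ((real ^ 3) \<times> real) set)) =
      measure lborel (convex hull (insert 0 Basis :: ((real ^ 3) \<times> real) set))"
    using compact_std_simplex by (intro measure_completion) (auto intro: borel_closed compact_imp_closed)
  then show ?thesis by (simp add: content_std_simplex fact_numeral)
qed

text \<open>A shear that fixes height 0 and moves \<open>(0, 1)\<close> to \<open>(p, 1)\<close>
  maps the standard simplex onto this one. It serves the origin, where all four terms of the plane
  are maximal.\<close>

lemma measure_cayley_simplex_vertex:
  fixes p :: "real ^ 3"
  shows "measure lebesgue (convex hull ({(0, 0), (p, 1::real)} \<union> range (\<lambda>i. (axis i 1, 0)))) = 1 / 24"
proof -
  define T where "T = (\<lambda>(x::real^3, s::real). (id x + s *\<^sub>R p, s))"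
  have "linear T"
    unfolding T_def by (rule linearI) (auto simp: algebra_simps)
  then have "convex hull ({(0, 0), (p, 1)} \<union> range (\<lambda>i. (axis i 1, 0))) = T ` (convex hull (insert 0 Basis))"
    by (subst convex_hull_linear_image)
      (auto simp: Basis_vec_prod_real T_def image_Un image_image zero_prod_def insert_commute)
  moreover have "measure lebesgue (T ` (convex hull (insert 0 Basis))) = 1 / 24"
    unfolding T_def
    by (subst measure_horizontal_shear[OF linear_id compact_std_simplex])
      (simp add: measure_std_simplex_vec3 matrix_id_mat_1)
  ultimately show ?thesis by simp
qed

text \<open>This serves the points of the \<open>j\<close>-th axis: a second term of
  \<open>g\<close> replaces the vertex \<open>axis j 1\<close> of the plane. The volume sees only
  the \<open>j\<close>-th component of the edge from \<open>p\<close> to \<open>q\<close>.\<close>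

lemma measure_cayley_simplex_edge:
  fixes p q :: "real ^ 3" and j :: 3
  shows "measure lebesgue (convex hull
      ({(0, 0), (p, 1::real), (q, 1)} \<union> (\<lambda>i. (axis i 1, 0)) ` (- {j}))) = \<bar>q $ j - p $ j\<bar> / 24"
proof -
  let ?B = "(\<lambda>i::3. (axis i (1::real), 0::real)) ` (- {j})"
  \<comment> \<open>\<open>R\<close> lifts the vertex \<open>axis j 1\<close> to height 1;
    \<open>T\<close> then sends \<open>(0, 1)\<close> to \<open>(p, 1)\<close> and
    \<open>(axis j 1, 1)\<close> to \<open>(q, 1)\<close>.\<close>
  define R where "R = (\<lambda>(x::real^3, s::real). (x, s + axis j 1 \<bullet> x))"
  \<comment> \<open>\<open>A\<close> sends \<open>axis j 1\<close> to \<open>q - p\<close> and fixes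
    the other unit vectors, so its determinant is \<open>q $ j - p $ j\<close>.\<close>
  define A where "A x = x + x $ j *\<^sub>R (q - p - axis j 1)" for x :: "real ^ 3"
  define T where "T = (\<lambda>(x, s). (A x + s *\<^sub>R p, s::real))"
  have linA: "linear A" unfolding A_def by (rule linearI) (auto simp: algebra_simps)
  have linR: "linear R" unfolding R_def by (rule linearI) (auto simp: algebra_simps inner_add_right)
  have linT: "linear T"
    unfolding T_def
    by (rule linearI) (auto simp: algebra_simps linear_add[OF linA] linear_scale[OF linA])
  have Basis_split: "(Basis :: ((real ^ 3) \<times> real) set) = {(0, 1), (axis j 1, 0)} \<union> ?B"
    unfolding Basis_vec_prod_real by auto
  have axis_j: "axis i (1::real) $ j = 0" if "i \<noteq> j" for i
    using that by (simp add: axis_def)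
  have RB: "R ` ?B = ?B" and TB: "T ` ?B = ?B"
    unfolding image_image
    by (rule image_cong, simp, simp add: R_def T_def A_def inner_axis_axis axis_j)+
  have "R ` (convex hull (insert 0 Basis)) = convex hull ({(0, 0), (0, 1), (axis j 1, 1)} \<union> ?B)"
    unfolding Basis_split convex_hull_linear_image[OF linR] image_insert image_Un RB
    by (simp add: R_def inner_axis_axis zero_prod_def)
  then have "T ` R ` (convex hull (insert 0 Basis)) = convex hull ({(0, 0), (p, 1), (q, 1)} \<union> ?B)"
    by (simp add: convex_hull_linear_image[OF linT] image_insert image_Un TB)
      (simp add: T_def A_def)
  moreover have "\<bar>det (matrix A)\<bar> = \<bar>q $ j - p $ j\<bar>"
  proof -
    have "j = 1 \<or> j = 2 \<or> j = 3" using exhaust_3 by blast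
    then show ?thesis
      by (auto simp: det_3 matrix_def A_def axis_def)
  qed
  moreover have "compact (R ` (convex hull (insert 0 Basis)))"
    by (rule compact_continuous_image[OF linear_continuous_on compact_std_simplex]) (use linR linear_linear in blast)
  ultimately show ?thesis
    using measure_horizontal_shear[OF linA, of "R ` (convex hull (insert 0 Basis))" p]
      measure_vertical_shear[OF compact_std_simplex, of "axis j 1 :: real ^ 3"]
    by (simp add: T_def[symmetric] R_def[symmetric] measure_std_simplex_vec3)
qed

text \<open>The interior of \<open>Q\<close> is dense in \<open>Q\<close>, so a point of
  \<open>Q\<close> missing from the closed set \<open>S\<close> yields a nonempty open part of
  \<open>Q\<close> outside \<open>S\<close>, which is not negligible.\<close>

lemma convex_eq_if_measure_eq:
  fixes S Q :: "'a::euclidean_space set"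
  assumes S: "compact S" and Q: "compact Q" "convex Q" and sub: "S \<subseteq> Q"
    and eq: "measure lebesgue S = measure lebesgue Q" and pos: "measure lebesgue Q > 0"
  shows "S = Q"
proof (rule ccontr)
  assume "S \<noteq> Q"
  then obtain x where x: "x \<in> Q" "x \<notin> S" using sub by blast
  have "\<not> negligible Q" using pos by (auto simp: negligible_imp_measure0)
  then have "interior Q \<noteq> {}" using negligible_convex_interior[OF Q(2)] by simp
  then have "x \<in> closure (interior Q)"
    using convex_closure_interior[OF Q(2)] x closure_subset by auto
  moreover have "open (- S)" using S by (simp add: compact_imp_closed open_Compl)
  ultimately have ne: "- S \<inter> interior Q \<noteq> {}"
    using x by (metis ComplI closure_iff_nhds_not_empty disjoint_iff open_Int_closure_eq_empty)
  let ?D = "- S \<inter> interior Q"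
  have "open ?D" using \<open>open (- S)\<close> by auto
  then have nD: "\<not> negligible ?D" using ne open_not_negligible by blast
  have "?D \<subseteq> Q - S" using interior_subset by blast
  then have "\<not> negligible (Q - S)" using nD negligible_subset by blast
  moreover have "measure lebesgue (Q - S) = measure lebesgue Q - measure lebesgue S"
    using S Q sub by (intro measurable_measure_Diff) (auto intro: lmeasurable_compact fmeasurableD)
  moreover have "Q - S \<in> lmeasurable" using S Q by (intro fmeasurable_Diff) (auto intro: lmeasurable_compact fmeasurableD)
  ultimately show False using eq by (simp add: negligible_iff_measure)
qed

subsection \<open>Tropical polynomials and smoothness\<close>

text \<open>Off the support this is the default value 0; \<open>max_affine\<close> is instantiated
  with the support as index set.\<close>

definition real_coeff :: "(nat ^ 'n \<Rightarrow> ereal) \<Rightarrow> nat ^ 'n \<Rightarrow> real" where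
  "real_coeff p e = real_of_ereal (p e)"

lemma real_vec_nth [simp]: "real_vec e $ i = real (e $ i)"
  by (simp add: real_vec_def)

lemma real_vec_inject [simp]: "real_vec e = real_vec e' \<longleftrightarrow> e = e'"
  by (simp add: vec_eq_iff)

lemma real_vec_0 [simp]: "real_vec 0 = 0"
  by (simp add: vec_eq_iff)

lemma real_vec_axis [simp]: "real_vec (axis i (Suc 0)) = axis i 1"
  by (simp add: vec_eq_iff axis_def)

locale tropical_polynomial =
  fixes p :: "nat ^ 'n \<Rightarrow> ereal"
  assumes trop_poly: "trop_poly p" and supp_nonempty: "trop_supp p \<noteq> {}"
begin

sublocale max_affine "trop_supp p" real_vec "real_coeff p"
  using trop_poly supp_nonempty by unfold_locales (auto simp: trop_poly_def)

lemma ereal_coeff: "e \<in> trop_supp p \<Longrightarrow> ereal (real_coeff p e) = p e"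
  using trop_poly by (cases "p e") (auto simp: real_coeff_def trop_poly_def trop_supp_def)

lemma term_value_supp:
  "e \<in> trop_supp p \<Longrightarrow> term_value p e t = ereal (real_coeff p e + real_vec e \<bullet> t)"
  by (simp add: term_value_def ereal_coeff[symmetric])

lemma max_terms_eq_active: "max_terms p t = active t"
proof -
  have "term_value p e t = -\<infinity>" if "e \<notin> trop_supp p" for e
    using that by (simp add: term_value_def trop_supp_def)
  then have "(\<forall>e'. term_value p e' t \<le> term_value p e t) \<longleftrightarrow>
      (\<forall>e'\<in>trop_supp p. real_coeff p e' + real_vec e' \<bullet> t \<le> real_coeff p e + real_vec e \<bullet> t)"
    if "e \<in> trop_supp p" for e
  proof -
    have "term_value p e' t \<le> term_value p e t \<longleftrightarrow>
        (e' \<in> trop_supp p \<longrightarrow> real_coeff p e' + real_vec e' \<bullet> t \<le> real_coeff p e + real_vec e \<bullet> t)" for e'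
      using that \<open>\<And>e. e \<notin> trop_supp p \<Longrightarrow> term_value p e t = -\<infinity>\<close>
      by (cases "e' \<in> trop_supp p") (simp_all add: term_value_supp)
    then show ?thesis by blast
  qed
  then show ?thesis unfolding max_terms_def active_iff by auto
qed

lemma le_coeff_iff: "ereal \<alpha> \<le> p e \<longleftrightarrow> e \<in> trop_supp p \<and> \<alpha> \<le> real_coeff p e"
proof (cases "e \<in> trop_supp p")
  case True
  then show ?thesis using ereal_coeff[OF True, symmetric] by simp
next
  case False
  then show ?thesis by (simp add: trop_supp_def)
qed

lemma max_terms_singletonD: "max_terms p t = {e} \<Longrightarrow> t \<notin> trop_variety p"
  by (auto simp: trop_variety_def)

text \<open>Off the variety a single term is active, and nearby active sets are nonempty subsets of
  that singleton.\<close>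

lemma max_terms_locally_constant:
  assumes "t \<notin> trop_variety p"
  shows "\<forall>\<^sub>F s in nhds t. max_terms p s = max_terms p t"
proof -
  obtain e where e: "max_terms p t = {e}"
    using assms active_nonempty[of t] unfolding max_terms_eq_active[symmetric]
    by (auto simp: trop_variety_def)
  show ?thesis
    using eventually_active_subset[of t]
    by eventually_elim (use e active_nonempty in \<open>auto simp: max_terms_eq_active\<close>)
qed

text \<open>The domain is the component of \<open>t\<close>; a locally constant set of maximal terms
  is constant on it.\<close>

lemma corresponds_exists:
  assumes e: "max_terms p t = {e}"
  obtains D where "t \<in> D" "corresponds p D e"
proof -
  define D where "D = connected_component_set (- trop_variety p) t"
  have t: "t \<in> - trop_variety p" using max_terms_singletonD[OF e] by simp
  then have tD: "t \<in> D" by (simp add: D_def)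
  have D: "D \<in> components (- trop_variety p)"
    unfolding D_def components_def using t by blast
  have conn: "connected D" unfolding D_def by simp
  have "max_terms p s = {e}" if s: "s \<in> D" for s
  proof -
    have "\<forall>a\<in>D. \<exists>T. openin (top_of_set D) T \<and> a \<in> T \<and> (\<forall>x\<in>T. max_terms p x = max_terms p a)"
    proof
      fix a assume a: "a \<in> D"
      then have "a \<notin> trop_variety p" using in_components_subset[OF D] by blast
      then obtain S where "open S" "a \<in> S" "\<forall>x\<in>S. max_terms p x = max_terms p a"
        using max_terms_locally_constant[of a] unfolding eventually_nhds by blast
      then show "\<exists>T. openin (top_of_set D) T \<and> a \<in> T \<and> (\<forall>x\<in>T. max_terms p x = max_terms p a)"
        using a openin_open_Int[of S D] by (intro exI[of _ "D \<inter> S"]) blast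
    qed
    then have "max_terms p constant_on D"
      using locally_constant_imp_constant[OF conn] by blast
    then show ?thesis using s tD e unfolding constant_on_def by metis
  qed
  then have "corresponds p D e" unfolding corresponds_def using D by blast
  then show ?thesis using that tD by blast
qed

lemma corresponds_iff:
  "(\<exists>D. t \<in> D \<and> corresponds p D e) \<longleftrightarrow> max_terms p t = {e}"
  by (metis corresponds_exists corresponds_def)

lemma exponent_at_eq: "max_terms p t = {e} \<Longrightarrow> exponent_at p t = e"
  unfolding exponent_at_def corresponds_iff by simp

end

locale tropical_pair = P: tropical_polynomial p + Q: tropical_polynomial q
  for p q :: "nat ^ 3 \<Rightarrow> ereal"
begin

text \<open>
  The last coordinate of the supporting functional is chosen so that the maxima of \<open>p\<close> and
  \<open>q\<close> at \<open>t\<close> get the same height.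
\<close>

lemma cayley_cell:
  "convex hull ((\<lambda>e. (real_vec e, 0)) ` max_terms p t \<union> (\<lambda>e. (real_vec e, 1)) ` max_terms q t)
    \<in> cayley_subdivision p q"
proof -
  \<comment> \<open>The tag tells equal exponents of \<open>p\<close> and \<open>q\<close> apart and
    becomes the last coordinate of the Cayley point.\<close>
  let ?I = "(\<lambda>e. (e, False)) ` trop_supp p \<union> (\<lambda>e. (e, True)) ` trop_supp q"
  define v :: "(nat ^ 3) \<times> bool \<Rightarrow> (real ^ 3) \<times> real" where "v = (\<lambda>(e, b). (real_vec e, of_bool b))"
  define c where "c = (\<lambda>(e, b). if b then real_coeff q e else real_coeff p e)"
  interpret C: max_affine ?I v c
    using P.finite_I P.nonempty_I Q.finite_I by unfold_locales auto
  define s where "s = (t, P.H t - Q.H t)"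
  have H: "C.H s = P.H t"
  proof (rule antisym)
    show "C.H s \<le> P.H t"
      by (rule C.H_le) (auto simp: s_def v_def c_def P.H_ge dest: Q.H_ge[of _ t])
    obtain e where e: "e \<in> P.active t" using P.active_nonempty by blast
    then show "P.H t \<le> C.H s"
      using C.H_ge[of "(e, False)" s] P.active_subset[of t]
      by (auto simp: s_def v_def c_def P.active_def)
  qed
  have "C.active s = (\<lambda>e. (e, False)) ` P.active t \<union> (\<lambda>e. (e, True)) ` Q.active t"
    unfolding C.active_def P.active_def Q.active_def H
    by (auto simp: s_def v_def c_def)
  then have "v ` C.active s =
      (\<lambda>e. (real_vec e, 0)) ` max_terms p t \<union> (\<lambda>e. (real_vec e, 1)) ` max_terms q t"
    by (simp add: image_Un image_image v_def P.max_terms_eq_active Q.max_terms_eq_active)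
  moreover have "{(v i, \<alpha>) | i \<alpha>. i \<in> ?I \<and> \<alpha> \<le> c i} =
      {((real_vec e, 0), \<alpha>) | e \<alpha>. ereal \<alpha> \<le> p e} \<union> {((real_vec e, 1), \<beta>) | e \<beta>. ereal \<beta> \<le> q e}"
    (is "?L = ?R1 \<union> ?R2")
  proof (intro equalityI subsetI)
    fix x assume "x \<in> ?L"
    then obtain i \<alpha> where "x = (v i, \<alpha>)" "i \<in> ?I" "\<alpha> \<le> c i" by blast
    then show "x \<in> ?R1 \<union> ?R2"
      by (auto simp: v_def c_def P.le_coeff_iff Q.le_coeff_iff)
  next
    fix x assume "x \<in> ?R1 \<union> ?R2"
    then consider e \<alpha> where "x = ((real_vec e, 0), \<alpha>)" "e \<in> trop_supp p" "\<alpha> \<le> real_coeff p e"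
      | e \<alpha> where "x = ((real_vec e, 1), \<alpha>)" "e \<in> trop_supp q" "\<alpha> \<le> real_coeff q e"
      by (auto simp: P.le_coeff_iff Q.le_coeff_iff)
    then show "x \<in> ?L"
    proof cases
      case 1
      then show ?thesis by (intro CollectI exI[of _ "(e, False)"] exI[of _ \<alpha>]) (auto simp: v_def c_def)
    next
      case 2
      then show ?thesis by (intro CollectI exI[of _ "(e, True)"] exI[of _ \<alpha>]) (auto simp: v_def c_def)
    qed
  qed
  ultimately show ?thesis
    using C.subgrads_cell[of s] unfolding cayley_subdivision_def C.hypograph_def C.subgrads_def by simp
qed

end

section \<open>Consequences of smoothness on the coordinate axes\<close>

text \<open>\<open>S\<close> has positive volume, so \<open>Q\<close> is four-dimensional and
  smoothness fixes its volume at the least value allowed for \<open>S\<close>; equal volumes force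
  equality.\<close>

lemma smooth_cell_eq:
  assumes smooth: "smooth_complete_intersection p q" and Q: "Q \<in> cayley_subdivision p q"
    and cQ: "compact Q" "convex Q" and S: "compact S" "S \<subseteq> Q" "measure lebesgue S \<ge> 1 / 24"
  shows "S = Q" "measure lebesgue Q = 1 / 24"
proof -
  have le: "measure lebesgue S \<le> measure lebesgue Q"
    using cQ S by (intro measure_mono_fmeasurable) (auto intro: lmeasurable_compact fmeasurableD)
  then have pos: "measure lebesgue Q > 0" using S(3) by simp
  then have "\<not> negligible Q" by (auto simp: negligible_imp_measure0)
  then have "interior Q \<noteq> {}" using negligible_convex_interior[OF cQ(2)] by simp
  then have "aff_dim Q = 4" by (simp add: aff_dim_nonempty_interior)
  then show mQ: "measure lebesgue Q = 1 / 24"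
    using smooth Q unfolding smooth_complete_intersection_def by blast
  show "S = Q"
    by (rule convex_eq_if_measure_eq) (use cQ S le mQ in auto)
qed

text \<open>Height 1 is a supporting hyperplane of the Cayley hull, so the points there come from
  the generators of height 1 alone. This reads terms of \<open>g\<close> off a known cell.\<close>

lemma hull_top_slice:
  assumes "(z, 1::real) \<in> convex hull ((\<lambda>a. (a, 0)) ` A \<union> (\<lambda>b. (b, 1)) ` B)"
  shows "(z::'a::euclidean_space) \<in> convex hull B"
proof -
  let ?G = "(\<lambda>a. (a, 0::real)) ` A \<union> (\<lambda>b. (b, 1)) ` B"
  have "convex hull ?G \<inter> {x. (0, 1) \<bullet> x = 1} = convex hull (?G \<inter> {x. (0, 1) \<bullet> x = 1})"
    by (rule hull_Int_supporting_hyperplane) auto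
  moreover have "?G \<inter> {x. (0, 1) \<bullet> x = 1} = (\<lambda>b. (b, 1)) ` B" by auto
  ultimately have "(z, 1) \<in> convex hull ((\<lambda>b. (b, 1::real)) ` B)" using assms by auto
  then have "z \<in> fst ` (convex hull ((\<lambda>b. (b, 1::real)) ` B))" by force
  then show ?thesis by (simp add: convex_hull_linear_image[OF linear_fst] image_image)
qed

lemma trop_plane_alt:
  "trop_plane e = (if e \<in> insert 0 (range (\<lambda>i. axis i 1)) then 0 else -\<infinity>)"
proof -
  have "vector [1, 0, 0] = (axis 1 1 :: nat ^ 3)" "vector [0, 1, 0] = (axis 2 1 :: nat ^ 3)"
    "vector [0, 0, 1] = (axis 3 1 :: nat ^ 3)" "vector [0, 0, 0] = (0 :: nat ^ 3)"
    by (simp_all add: vec_eq_iff forall_3 vector_3 axis_def)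
  moreover have "range (\<lambda>i. axis i (1::nat)) = {axis 1 1, axis 2 1, axis 3 1 :: nat ^ 3}"
    by (simp add: UNIV_3)
  ultimately show ?thesis by (auto simp: trop_plane_def)
qed

interpretation plane: tropical_polynomial trop_plane
proof
  have "trop_supp trop_plane = insert 0 (range (\<lambda>i. axis i 1))"
    by (auto simp: trop_supp_def trop_plane_alt)
  then show "trop_poly trop_plane" "trop_supp trop_plane \<noteq> {}"
    by (auto simp: trop_poly_def trop_plane_alt)
qed

text \<open>On this half-axis the term \<open>axis j 1\<close> has value \<open>x \<le> 0\<close>,
  and the other three have value 0.\<close>

lemma max_terms_trop_plane:
  assumes "x \<le> 0"
  shows "0 \<in> max_terms trop_plane (x *\<^sub>R axis j 1)"
    and "i \<noteq> j \<or> x = 0 \<Longrightarrow> axis i 1 \<in> max_terms trop_plane (x *\<^sub>R axis j 1)"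
  using assms
  by (auto simp: max_terms_def trop_supp_def trop_plane_alt term_value_def inner_axis_axis mult_nonneg_nonneg)

locale smooth_plane_section = tropical_polynomial g for g :: "nat ^ 3 \<Rightarrow> ereal" +
  assumes smooth: "smooth_complete_intersection trop_plane g"
begin

sublocale pair: tropical_pair trop_plane g ..

abbreviation cell :: "real ^ 3 \<Rightarrow> ((real ^ 3) \<times> real) set" where
  "cell t \<equiv> convex hull ((\<lambda>e. (real_vec e, 0)) ` max_terms trop_plane t \<union>
     (\<lambda>e. (real_vec e, 1)) ` max_terms g t)"

lemma cell_eq:
  assumes S: "S = convex hull X" "finite X" "X \<subseteq> cell t" "measure lebesgue S \<ge> 1 / 24"
  shows "S = cell t" "measure lebesgue S = 1 / 24"
proof -
  have "compact (cell t)"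
    using plane.finite_active[of t] finite_active[of t]
    by (intro finite_imp_compact_convex_hull)
      (auto simp: plane.max_terms_eq_active max_terms_eq_active)
  moreover have "S \<subseteq> cell t" unfolding S(1) by (rule hull_minimal[OF S(3)]) simp
  moreover have "compact S" unfolding S(1) by (rule finite_imp_compact_convex_hull[OF S(2)])
  ultimately have "S = cell t \<and> measure lebesgue (cell t) = 1 / 24"
    using smooth_cell_eq[OF smooth pair.cayley_cell[of t]] S(4) by (metis convex_convex_hull)
  then show "S = cell t" "measure lebesgue S = 1 / 24" by auto
qed

text \<open>All four terms of the plane are maximal at the origin, so any maximal term of
  \<open>g\<close> spans with them a simplex of volume \<open>1 / 24\<close>, which fills the cell.
  Its top slice is one point.\<close>

lemma max_terms_origin:
  assumes "e \<in> max_terms g 0" "e' \<in> max_terms g 0"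
  shows "e' = e"
proof -
  let ?X = "{(0, 0), (real_vec e, 1)} \<union> range (\<lambda>i. (axis i 1, 0))"
  have pl: "0 \<in> max_terms trop_plane 0" "axis i 1 \<in> max_terms trop_plane 0" for i
    using max_terms_trop_plane[of 0] by auto
  have "?X \<subseteq> (\<lambda>e. (real_vec e, 0)) ` max_terms trop_plane 0 \<union> (\<lambda>e. (real_vec e, 1)) ` max_terms g 0"
    using assms(1) pl by (force simp: image_iff)
  then have X: "?X \<subseteq> cell 0" by (rule subset_trans) (rule hull_subset)
  have "convex hull ?X = cell 0"
    by (rule cell_eq(1)[OF refl _ X]) (simp, simp only: measure_cayley_simplex_vertex)
  moreover have "(real_vec e', 1) \<in> cell 0" using assms(2) by (intro hull_inc) auto
  moreover have "?X = (\<lambda>a. (a, 0)) ` insert 0 (range (\<lambda>i. axis i 1)) \<union> (\<lambda>b. (b, 1)) ` {real_vec e}"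
    by auto
  ultimately have "real_vec e' \<in> convex hull {real_vec e}"
    using hull_top_slice by metis
  then show ?thesis by simp
qed

text \<open>Three terms of the plane with \<open>e\<close> and \<open>e'\<close> span a simplex
  whose volume is a positive integer multiple of \<open>1 / 24\<close>; smoothness makes the integer
  1 and the simplex the whole cell. A segment whose \<open>j\<close>-th coordinate changes by 1 has
  no lattice points but its ends.\<close>

lemma max_terms_axis_step:
  assumes x: "x \<le> 0" and e: "e \<in> max_terms g (x *\<^sub>R axis j 1)" and e': "e' \<in> max_terms g (x *\<^sub>R axis j 1)"
    and ne: "e $ j \<noteq> e' $ j"
  shows "\<bar>real (e' $ j) - real (e $ j)\<bar> = 1" "max_terms g (x *\<^sub>R axis j 1) = {e, e'}"
proof -
  define t where "t = x *\<^sub>R axis j (1::real)"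
  let ?B = "(\<lambda>i. (axis i 1, 0)) ` (- {j})"
  let ?X = "{(0, 0), (real_vec e, 1::real), (real_vec e', 1)} \<union> ?B"
  have pl: "0 \<in> max_terms trop_plane t" "i \<noteq> j \<Longrightarrow> axis i 1 \<in> max_terms trop_plane t" for i
    unfolding t_def using max_terms_trop_plane[OF x] by auto
  have "?X \<subseteq> (\<lambda>e. (real_vec e, 0)) ` max_terms trop_plane t \<union> (\<lambda>e. (real_vec e, 1)) ` max_terms g t"
    using e e' pl unfolding t_def[symmetric] by (force simp: image_iff)
  then have X: "?X \<subseteq> cell t" by (rule subset_trans) (rule hull_subset)
  have m: "measure lebesgue (convex hull ?X) = \<bar>real (e' $ j) - real (e $ j)\<bar> / 24"
    by (rule trans[OF measure_cayley_simplex_edge]) simp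
  have "1 \<le> \<bar>real (e' $ j) - real (e $ j)\<bar>" using ne by linarith
  then have ge: "measure lebesgue (convex hull ?X) \<ge> 1 / 24" unfolding m by simp
  have eq: "convex hull ?X = cell t" and mX: "measure lebesgue (convex hull ?X) = 1 / 24"
    by (rule cell_eq[OF refl _ X ge]; simp)+
  show d: "\<bar>real (e' $ j) - real (e $ j)\<bar> = 1" using m mX by simp
  have "f \<in> {e, e'}" if f: "f \<in> max_terms g t" for f
  proof -
    have "(real_vec f, 1) \<in> convex hull ?X" unfolding eq using f by (intro hull_inc) auto
    moreover have "?X = (\<lambda>a. (a, 0)) ` insert 0 ((\<lambda>i. axis i 1) ` (- {j})) \<union>
        (\<lambda>b. (b, 1)) ` {real_vec e, real_vec e'}"
      by auto
    ultimately have "real_vec f \<in> convex hull {real_vec e, real_vec e'}"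
      using hull_top_slice by metis
    then obtain u where u: "0 \<le> u" "u \<le> 1" and
      f_eq: "real_vec f = (1 - u) *\<^sub>R real_vec e + u *\<^sub>R real_vec e'"
      unfolding segment_convex_hull[symmetric] in_segment by blast
    have "real_vec f $ j = (1 - u) * real_vec e $ j + u * real_vec e' $ j"
      unfolding f_eq by simp
    then have fj: "real (f $ j) - real (e $ j) = u * (real (e' $ j) - real (e $ j))"
      by (simp add: algebra_simps)
    have "real (e' $ j) - real (e $ j) = 1 \<or> real (e' $ j) - real (e $ j) = - 1"
      using d by (auto simp: abs_if split: if_splits)
    then have "real_of_int (int (f $ j) - int (e $ j)) = u \<or> real_of_int (int (f $ j) - int (e $ j)) = - u"
      using fj by auto
    then obtain k :: int where k: "u = of_int k"
      by (metis of_int_minus minus_minus)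
    then have "k = 0 \<or> k = 1" using u by auto
    then have "u = 0 \<or> u = 1" using k by auto
    then have "real_vec f = real_vec e \<or> real_vec f = real_vec e'" using f_eq by auto
    then show ?thesis by simp
  qed
  then show "max_terms g (x *\<^sub>R axis j 1) = {e, e'}" using e e' unfolding t_def by blast
qed

text \<open>
  Terms with equal exponent of the \<open>j\<close>-th variable that tie at a point of the axis keep tying
  along the axis. Moving towards the origin, the tie survives until a third term with another
  exponent joins, or until the origin is reached; smoothness excludes both.
\<close>

lemma max_terms_axis:
  assumes x: "x \<le> 0" and e: "e \<in> max_terms g (x *\<^sub>R axis j 1)" and e': "e' \<in> max_terms g (x *\<^sub>R axis j 1)"
    and ne: "e \<noteq> e'"
  shows "\<bar>real (e' $ j) - real (e $ j)\<bar> = 1" "max_terms g (x *\<^sub>R axis j 1) = {e, e'}"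
proof -
  have "e $ j \<noteq> e' $ j"
  proof
    assume eqj: "e $ j = e' $ j"
    define tie where "tie = {y \<in> {x..0}. e \<in> max_terms g (y *\<^sub>R axis j 1)}"
    have e_supp: "e \<in> trop_supp g" "e' \<in> trop_supp g" using e e' by (auto simp: max_terms_def)
    \<comment> \<open>With equal \<open>j\<close>-exponents the values of both terms differ by a
      constant along the axis; a tie at one point makes it 0.\<close>
    have coeff_eq: "real_coeff g e = real_coeff g e'"
      using e e' eqj by (auto simp: max_terms_eq_active active_def inner_axis)
    have tie_both: "e' \<in> max_terms g (y *\<^sub>R axis j 1)" if "e \<in> max_terms g (y *\<^sub>R axis j 1)" for y
      using that e_supp eqj coeff_eq by (auto simp: max_terms_eq_active active_def inner_axis)
    have tie_eq: "tie = {x..0} \<inter> (\<Inter>f\<in>trop_supp g. {y. real_coeff g f + y * real (f $ j) \<le> real_coeff g e + y * real (e $ j)})"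
      using e_supp by (auto simp: tie_def max_terms_eq_active active_iff inner_axis)
    have "closed tie"
      unfolding tie_eq by (intro closed_Int closed_INT ballI closed_Collect_le continuous_intros)
    then have "compact tie"
      unfolding compact_eq_bounded_closed
      by (auto simp: tie_def intro: bounded_subset[of "{x..0}"])
    moreover have "x \<in> tie" using x e by (simp add: tie_def)
    ultimately obtain y where y: "y \<in> tie" and ymax: "\<And>z. z \<in> tie \<Longrightarrow> z \<le> y"
      using compact_attains_sup[of tie] by blast
    have ey: "e \<in> max_terms g (y *\<^sub>R axis j 1)" and y0: "y \<le> 0" and xy: "x \<le> y"
      using y by (auto simp: tie_def)
    have e'y: "e' \<in> max_terms g (y *\<^sub>R axis j 1)" by (rule tie_both[OF ey])
    have "y \<noteq> 0" using max_terms_origin[of e e'] ey e'y ne by auto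
    \<comment> \<open>Another \<open>j\<close>-exponent would make \<open>{e, f}\<close> the whole
      set of maximal terms, with no room for \<open>e'\<close>.\<close>
    have same: "f $ j = e $ j" if f: "f \<in> max_terms g (y *\<^sub>R axis j 1)" for f
    proof (rule ccontr)
      assume "f $ j \<noteq> e $ j"
      then have "max_terms g (y *\<^sub>R axis j 1) = {e, f}"
        using max_terms_axis_step(2)[OF y0 ey f] by simp
      then show False using e'y ne eqj \<open>f $ j \<noteq> e $ j\<close> by auto
    qed
    have "\<forall>\<^sub>F \<delta> in at_right 0. \<delta> < - y \<and> \<delta> > 0 \<and>
        active (y *\<^sub>R axis j 1 + \<delta> *\<^sub>R axis j 1) \<subseteq> active (y *\<^sub>R axis j 1)"
    proof (intro eventually_conj)
      show "\<forall>\<^sub>F \<delta> in at_right 0. \<delta> < - y"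
        using eventually_at_right_real[of 0 "- y"] \<open>y \<noteq> 0\<close> y0 by (auto elim: eventually_mono)
    qed (rule eventually_at_right_less eventually_active_subset_dir)+
    then obtain \<delta> where \<delta>: "\<delta> < - y" "\<delta> > 0"
        and sub: "active (y *\<^sub>R axis j 1 + \<delta> *\<^sub>R axis j 1) \<subseteq> active (y *\<^sub>R axis j 1)"
      using eventually_happens'[OF trivial_limit_at_right_real] by blast
    obtain f where f: "f \<in> active (y *\<^sub>R axis j 1 + \<delta> *\<^sub>R axis j 1)"
      using active_nonempty by blast
    have comb: "y *\<^sub>R axis j 1 + \<delta> *\<^sub>R axis j 1 = (y + \<delta>) *\<^sub>R (axis j 1 :: real ^ 3)"
      by (simp add: scaleR_left_distrib)
    \<comment> \<open>On the axis \<open>f\<close> and \<open>e\<close> have the same value, so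
      \<open>e\<close> is still maximal beyond the last tie point \<open>y\<close>.\<close>
    have "f \<in> active (y *\<^sub>R axis j 1)" using f sub by blast
    then have "f $ j = e $ j" "real_coeff g f = real_coeff g e"
      using same[of f] ey by (auto simp: max_terms_eq_active active_def inner_axis)
    then have "e \<in> max_terms g ((y + \<delta>) *\<^sub>R axis j 1)"
      using f e_supp unfolding comb by (auto simp: max_terms_eq_active active_def inner_axis)
    then have "y + \<delta> \<in> tie" using \<delta> xy by (simp add: tie_def)
    then show False using ymax \<delta> by fastforce
  qed
  then show "\<bar>real (e' $ j) - real (e $ j)\<bar> = 1" "max_terms g (x *\<^sub>R axis j 1) = {e, e'}"
    using max_terms_axis_step[OF x e e'] by auto
qed

end

subsection \<open>The marked complex of a planar section\<close>

lemma UNIV_2_distinct: "k \<noteq> k' \<Longrightarrow> UNIV = {k, k' :: 2}"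
  using exhaust_2[of k] exhaust_2[of k'] by (auto simp: UNIV_2)

lemma inner_vec2: "k \<noteq> k' \<Longrightarrow> (x :: real ^ 2) \<bullet> y = x $ k * y $ k + x $ k' * y $ k'"
  by (simp add: inner_vec_def UNIV_2_distinct)

lemma vec2_eqI: "k \<noteq> k' \<Longrightarrow> (x :: 'a ^ 2) $ k = y $ k \<Longrightarrow> x $ k' = y $ k' \<Longrightarrow> x = y"
  using exhaust_2[of k] exhaust_2[of k'] by (auto simp: vec_eq_iff forall_2)

lemma axis_nth_neq: "i \<noteq> j \<Longrightarrow> axis i x $ j = 0"
  by (simp add: axis_def)

text \<open>The range includes \<open>u = 1\<close>, where the floor is already \<open>Suc n\<close>
  and the fractional part is 0.\<close>

lemma lin_interp_between:
  assumes "0 \<le> u" "u \<le> 1"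
  shows "lin_interp w (real n + u) = (1 - u) * w n + u * w (Suc n)"
proof (cases "u = 1")
  case True
  then show ?thesis by (simp add: lin_interp_def frac_def nat_add_distrib)
next
  case False
  then have "\<lfloor>real n + u\<rfloor> = int n" using assms by (intro floor_unique) auto
  then show ?thesis by (simp add: lin_interp_def frac_def)
qed

lemma lin_interp_nat: "lin_interp w (real n) = w n"
  using lin_interp_between[of 0 w n] by simp

lemma convex_nth_between:
  fixes C :: "(real ^ 'n) set"
  assumes "convex C" "a \<in> C" "b \<in> C" "a $ k \<le> s" "s \<le> b $ k"
  obtains p where "p \<in> C" "p $ k = s"
proof -
  have "linear (\<lambda>x :: real ^ 'n. x $ k)" by (rule linearI) auto
  then have "convex ((\<lambda>x. x $ k) ` C)" using assms(1) convex_linear_image by blast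
  then have "connected ((\<lambda>x. x $ k) ` C)" by (rule convex_connected)
  then have "{a $ k .. b $ k} \<subseteq> (\<lambda>x. x $ k) ` C"
    using assms by (intro connected_contains_Icc) auto
  then show ?thesis using assms that by fastforce
qed

text \<open>Feasible directions of the quadrant, one coordinate at a time: free where the constraint
  is slack, nonpositive where it is tight.\<close>

lemma eventually_nonpos_dir:
  assumes "a < 0 \<or> a = 0 \<and> b \<le> 0"
  shows "\<forall>\<^sub>F \<delta> in at_right (0::real). a + \<delta> * b \<le> 0"
proof (cases "a < 0")
  case True
  have "((\<lambda>\<delta>. a + \<delta> * b) \<longlongrightarrow> a + 0 * b) (at_right 0)" by (intro tendsto_intros)
  then have "\<forall>\<^sub>F \<delta> in at_right 0. a + \<delta> * b < 0" using True by (intro order_tendstoD) auto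
  then show ?thesis by (rule eventually_mono) simp
next
  case False
  then have "a = 0" "b \<le> 0" using assms by auto
  then show ?thesis
    using eventually_at_right_less[of "0::real"]
    by (auto elim!: eventually_mono simp: mult_nonneg_nonpos)
qed

text \<open>The planar argument takes from smoothness that no terms tie at the origin and that ties
  on the half-axes have unit steps. The index \<open>k\<close> lets one proof serve both
  \<open>u\<close> and \<open>r\<close>.\<close>

locale planar_section = tropical_polynomial h for h :: "nat ^ 2 \<Rightarrow> ereal" +
  fixes e0 :: "nat ^ 2"
  assumes zero_supp: "0 \<in> trop_supp h"
    and origin: "max_terms h 0 = {e0}"
    and axis_step: "\<lbrakk>x \<le> 0; e \<in> max_terms h (x *\<^sub>R axis k 1); e' \<in> max_terms h (x *\<^sub>R axis k 1); e \<noteq> e'\<rbrakk>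
      \<Longrightarrow> \<bar>real (e' $ k) - real (e $ k)\<bar> = 1 \<and> max_terms h (x *\<^sub>R axis k 1) = {e, e'}"
begin

definition quadrant :: "(real ^ 2) set" where
  "quadrant = {t. t $ 1 \<le> 0 \<and> t $ 2 \<le> 0}"

lemma quadrant_iff: "k \<noteq> k' \<Longrightarrow> t \<in> quadrant \<longleftrightarrow> t $ k \<le> 0 \<and> t $ k' \<le> 0"
  unfolding quadrant_def using exhaust_2[of k] exhaust_2[of k'] by auto

text \<open>The common form of \<open>u_vertex\<close> and \<open>r_vertex\<close>, with domains
  replaced by points that have a single maximal term.\<close>

definition axis_vertex :: "2 \<Rightarrow> 2 \<Rightarrow> nat \<Rightarrow> int" where
  "axis_vertex k k' i = (THE l. \<exists>e x. x \<le> 0 \<and> max_terms h (x *\<^sub>R axis k 1) = {e} \<and>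
     e $ k = i \<and> int (e $ k') = l)"

text \<open>On the axis two terms with the same \<open>k\<close>-exponent differ by a constant; as
  each is maximal somewhere, the constant is 0 and they tie.\<close>

lemma axis_vertex_unique:
  assumes "max_terms h (x *\<^sub>R axis k 1) = {e}" "max_terms h (y *\<^sub>R axis k 1) = {e'}" "e $ k = e' $ k"
  shows "e = e'"
proof -
  have e: "e \<in> active (x *\<^sub>R axis k 1)" and e': "e' \<in> active (y *\<^sub>R axis k 1)"
    using assms(1,2) by (auto simp: max_terms_eq_active)
  then have "real_coeff h e = real_coeff h e'"
    using assms(3) H_ge[of e "y *\<^sub>R axis k 1"] H_ge[of e' "x *\<^sub>R axis k 1"]
    by (auto simp: active_def inner_axis)
  then have "e \<in> active (y *\<^sub>R axis k 1)"
    using e e' assms(3) by (auto simp: active_def inner_axis)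
  then show ?thesis using assms(2) by (simp add: max_terms_eq_active)
qed

text \<open>A small move in direction \<open>\<sigma>\<close> along the axis breaks the tie in
  favour of the larger slope; \<open>x < 0\<close> leaves room for either sign.\<close>

lemma perturb_to_vertex:
  assumes M: "max_terms h (x *\<^sub>R axis k 1) = {e, e'}" and x: "x < 0"
    and d: "\<sigma> = 1 \<or> \<sigma> = - 1" "\<sigma> * real (e' $ k) < \<sigma> * real (e $ k)"
  obtains y where "y \<le> 0" "max_terms h (y *\<^sub>R axis k 1) = {e}"
proof -
  let ?t = "x *\<^sub>R axis k (1::real)" and ?d = "\<sigma> *\<^sub>R axis k (1::real)"
  have "\<forall>\<^sub>F \<delta> in at_right 0. \<delta> \<in> {0<..< - x} \<and> active (?t + \<delta> *\<^sub>R ?d) \<subseteq> active ?t"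
    using eventually_at_right_real[of 0 "- x"] x eventually_active_subset_dir[of ?t ?d]
    by (auto elim: eventually_elim2)
  then obtain \<delta> where \<delta>: "\<delta> \<in> {0<..< - x}" "active (?t + \<delta> *\<^sub>R ?d) \<subseteq> active ?t"
    using eventually_happens'[OF trivial_limit_at_right_real] by blast
  have "e' \<notin> active (?t + \<delta> *\<^sub>R ?d)"
  proof
    assume "e' \<in> active (?t + \<delta> *\<^sub>R ?d)"
    then have "real_vec e \<bullet> ?d \<le> real_vec e' \<bullet> ?d"
      using active_dir_maximal[OF \<delta>(2)] \<delta>(1) M by (auto simp: max_terms_eq_active)
    then show False using d(2) by (simp add: inner_axis)
  qed
  then have "active (?t + \<delta> *\<^sub>R ?d) = {e}"
    using \<delta>(2) M active_nonempty[of "?t + \<delta> *\<^sub>R ?d"] by (auto simp: max_terms_eq_active)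
  moreover have "?t + \<delta> *\<^sub>R ?d = (x + \<delta> * \<sigma>) *\<^sub>R axis k 1" by (simp add: scaleR_left_distrib)
  ultimately have "max_terms h ((x + \<delta> * \<sigma>) *\<^sub>R axis k 1) = {e}" by (simp add: max_terms_eq_active)
  moreover have "x + \<delta> * \<sigma> \<le> 0" using d(1) \<delta>(1) x by auto
  ultimately show ?thesis using that by blast
qed

lemma axis_term_vertex:
  assumes x: "x \<le> 0" and e: "e \<in> max_terms h (x *\<^sub>R axis k 1)"
  obtains y where "y \<le> 0" "max_terms h (y *\<^sub>R axis k 1) = {e}"
proof (cases "\<exists>e'. e' \<noteq> e \<and> e' \<in> max_terms h (x *\<^sub>R axis k 1)")
  case False
  then have "max_terms h (x *\<^sub>R axis k 1) = {e}" using e by auto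
  then show ?thesis using that x by blast
next
  case True
  then obtain e' where e': "e' \<noteq> e" "e' \<in> max_terms h (x *\<^sub>R axis k 1)" by blast
  have "x \<noteq> 0" using e e' origin by auto
  then have x: "x < 0" using x by simp
  have M: "max_terms h (x *\<^sub>R axis k 1) = {e, e'}" and d: "\<bar>real (e' $ k) - real (e $ k)\<bar> = 1"
    using axis_step[of x e k e'] x e e' by auto
  define \<sigma> where "\<sigma> = real (e $ k) - real (e' $ k)"
  have "\<sigma> = 1 \<or> \<sigma> = - 1" using d by (auto simp: \<sigma>_def abs_if split: if_splits)
  moreover from this have "\<sigma> * real (e' $ k) < \<sigma> * real (e $ k)"
    by (auto simp: \<sigma>_def)
  ultimately show ?thesis using perturb_to_vertex[OF M x] that by blast
qed

text \<open>A term that only takes part in a tie at \<open>x\<close> is the sole maximum at another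
  point of the half-axis, so both ends of an edge are covered.\<close>

lemma axis_vertex_eq:
  assumes "x \<le> 0" "e \<in> max_terms h (x *\<^sub>R axis k 1)"
  shows "axis_vertex k k' (e $ k) = int (e $ k')"
proof -
  obtain y where y: "y \<le> 0" "max_terms h (y *\<^sub>R axis k 1) = {e}"
    using axis_term_vertex[OF assms] by blast
  show ?thesis
    unfolding axis_vertex_def
  proof (rule the_equality)
    show "\<exists>f x. x \<le> 0 \<and> max_terms h (x *\<^sub>R axis k 1) = {f} \<and> f $ k = e $ k \<and> int (f $ k') = int (e $ k')"
      using y by blast
  next
    fix l assume "\<exists>f x. x \<le> 0 \<and> max_terms h (x *\<^sub>R axis k 1) = {f} \<and> f $ k = e $ k \<and> int (f $ k') = l"
    then show "l = int (e $ k')" using axis_vertex_unique y(2) by metis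
  qed
qed

section \<open>Subgradients on the half-axes\<close>

lemma subgrads_nonneg: "w \<in> subgrads t \<Longrightarrow> 0 \<le> w $ k"
proof -
  have "subgrads t \<subseteq> {w. 0 \<le> w $ k}"
    unfolding subgrads_def
  proof (rule hull_minimal)
    have "{w :: real ^ 2. 0 \<le> w $ k} = {w. axis k 1 \<bullet> w \<ge> 0}" by (simp add: inner_axis')
    then show "convex {w :: real ^ 2. 0 \<le> w $ k}" by (simp add: convex_halfspace_ge)
  qed auto
  then show "w \<in> subgrads t \<Longrightarrow> 0 \<le> w $ k" by blast
qed

lemma subgrads_origin: "subgrads 0 = {real_vec e0}"
  using origin by (simp add: subgrads_def max_terms_eq_active)

text \<open>Monotonicity against the origin, where \<open>e0\<close> is the only
  subgradient.\<close>

lemma subgrads_axis_le: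
  assumes "x \<le> 0" "w \<in> subgrads (x *\<^sub>R axis k 1)"
  shows "w $ k \<le> real (e0 $ k)"
proof (cases "x = 0")
  case True
  then show ?thesis using assms subgrads_origin by simp
next
  case False
  have "0 \<le> (w - real_vec e0) \<bullet> (x *\<^sub>R axis k 1 - 0)"
    using assms(2) subgrads_origin by (intro subgrads_monotone) auto
  then have "0 \<le> x * (w $ k - real (e0 $ k))" by (simp add: inner_axis)
  then show ?thesis using False assms(1) by (simp add: zero_le_mult_iff)
qed

text \<open>The subdifferential is a vertex, or an edge along which the \<open>k\<close>-exponent
  grows by 1 and thus a piece of the interpolated graph.\<close>

lemma subgrads_axis_lin_interp:
  assumes x: "x \<le> 0" and w: "w \<in> subgrads (x *\<^sub>R axis k 1)"
  shows "w $ k' = lin_interp (axis_vertex k k') (w $ k)"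
proof (cases "\<exists>e. max_terms h (x *\<^sub>R axis k 1) = {e}")
  case True
  then obtain e where e: "max_terms h (x *\<^sub>R axis k 1) = {e}" by blast
  then have "w = real_vec e" using w by (simp add: subgrads_def max_terms_eq_active)
  then show ?thesis using axis_vertex_eq[OF x, of e k k'] e by (simp add: lin_interp_nat)
next
  case False
  obtain f where f: "f \<in> max_terms h (x *\<^sub>R axis k 1)"
    using active_nonempty by (auto simp: max_terms_eq_active)
  then obtain f' where f': "f' \<in> max_terms h (x *\<^sub>R axis k 1)" "f' \<noteq> f" using False by blast
  have "\<exists>e e'. max_terms h (x *\<^sub>R axis k 1) = {e, e'} \<and> e' $ k = Suc (e $ k)"
  proof -
    have "\<bar>real (f' $ k) - real (f $ k)\<bar> = 1" "max_terms h (x *\<^sub>R axis k 1) = {f, f'}"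
      using axis_step[OF x f f'(1)] f'(2) by auto
    moreover from this have "f' $ k = Suc (f $ k) \<or> f $ k = Suc (f' $ k)" by linarith
    ultimately show ?thesis by blast
  qed
  then obtain e e' where M: "max_terms h (x *\<^sub>R axis k 1) = {e, e'}" and suc: "e' $ k = Suc (e $ k)" by blast
  have "w \<in> closed_segment (real_vec e) (real_vec e')"
    using w M by (simp add: subgrads_def max_terms_eq_active segment_convex_hull)
  then obtain u where u: "0 \<le> u" "u \<le> 1" and w_eq: "w = (1 - u) *\<^sub>R real_vec e + u *\<^sub>R real_vec e'"
    unfolding in_segment by blast
  have "w $ k = real (e $ k) + u" using suc by (simp add: w_eq algebra_simps)
  moreover have "axis_vertex k k' (e $ k) = int (e $ k')" "axis_vertex k k' (Suc (e $ k)) = int (e' $ k')"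
    using axis_vertex_eq[OF x, of _ k k'] M suc by (auto simp: suc[symmetric])
  ultimately show ?thesis using u by (simp add: lin_interp_between w_eq)
qed

section \<open>Minimisers on the quadrant\<close>

text \<open>The quadrant is the polar cone of the unit vectors, and \<open>w\<close> minus the
  exponent of the constant monomial lies in the cone that they generate.\<close>

lemma quadrant_minimiser:
  assumes "0 \<le> w $ 1" "0 \<le> w $ 2"
  obtains t where "t \<in> quadrant" "\<And>s. s \<in> quadrant \<Longrightarrow> H t - w \<bullet> t \<le> H s - w \<bullet> s"
proof -
  let ?B = "{axis 1 1, axis 2 1 :: real ^ 2}"
  have "w = (w $ 1) *\<^sub>R axis 1 1 + (w $ 2) *\<^sub>R axis 2 1"
    by (simp add: vec_eq_iff forall_2 axis_def)
  also have "\<dots> \<in> convex_cone hull ?B"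
    using assms by (intro convex_cone_hull_add convex_cone_hull_mul hull_inc) auto
  finally have "w - real_vec 0 \<in> convex_cone hull ?B" by simp
  moreover have "(\<forall>b\<in>?B. s \<bullet> b \<le> 0) \<longleftrightarrow> s \<in> quadrant" for s
    by (simp add: quadrant_def inner_axis)
  ultimately show ?thesis
    using minimiser_exists[of ?B 0 w] zero_supp that by (metis finite.emptyI finite.insertI)
qed

text \<open>First-order condition at a minimum under the constraint \<open>P\<close>: along a
  feasible direction \<open>H\<close> grows at least as fast as the linear function of
  \<open>w\<close>.\<close>

lemma minimiser_direction:
  assumes feas: "\<forall>\<^sub>F \<delta> in at_right 0. P (t + \<delta> *\<^sub>R d)"
    and min: "\<And>s. P s \<Longrightarrow> H t - w \<bullet> t \<le> H s - w \<bullet> s"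
  obtains i where "i \<in> max_terms h t" "w \<bullet> d \<le> real_vec i \<bullet> d"
proof -
  have "\<forall>\<^sub>F \<delta> in at_right 0. H t + \<delta> * (w \<bullet> d) \<le> H (t + \<delta> *\<^sub>R d)"
    using feas
  proof eventually_elim
    case (elim \<delta>)
    then show ?case using min[OF elim] by (simp add: inner_add_right)
  qed
  then show ?thesis using active_direction[of t w d] that by (auto simp: max_terms_eq_active)
qed

text \<open>Minimise \<open>H\<close> minus \<open>s\<close> times the \<open>k\<close>-th
  coordinate over the half-axis. The two directions along it give active terms with
  \<open>k\<close>-exponents on either side of \<open>s\<close>, and convexity fills the gap; at the
  origin \<open>e0\<close> supplies the upper side.\<close>

lemma axis_subgrad_exists:
  assumes k: "k \<noteq> k'" and s: "0 \<le> s" "s \<le> real (e0 $ k)"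
  obtains x p where "x \<le> 0" "p \<in> subgrads (x *\<^sub>R axis k 1)" "p $ k = s"
proof -
  \<comment> \<open>Both signs of \<open>axis k' 1\<close> force \<open>t $ k' = 0\<close>, which
    confines the minimisation to the half-axis.\<close>
  let ?B = "{axis k 1, axis k' 1, - axis k' 1 :: real ^ 2}" and ?w = "s *\<^sub>R axis k 1 :: real ^ 2"
  have B: "(\<forall>b\<in>?B. t \<bullet> b \<le> 0) \<longleftrightarrow> t $ k \<le> 0 \<and> t $ k' = 0" for t
    by (auto simp: inner_axis)
  have "?w - real_vec 0 \<in> convex_cone hull ?B"
    using s by (simp add: convex_cone_hull_mul hull_inc)
  then obtain t where t: "t $ k \<le> 0" "t $ k' = 0"
    and min: "\<And>r. r $ k \<le> 0 \<and> r $ k' = 0 \<Longrightarrow> H t - ?w \<bullet> t \<le> H r - ?w \<bullet> r"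
    using minimiser_exists[of ?B 0 ?w] zero_supp unfolding B by (metis finite.emptyI finite.insertI)
  have t_eq: "t = t $ k *\<^sub>R axis k 1"
    using k t by (intro vec2_eqI[OF k]) (auto simp: axis_nth_neq)
  have "\<forall>\<^sub>F \<delta> in at_right 0. (t + \<delta> *\<^sub>R (- axis k 1)) $ k \<le> 0 \<and> (t + \<delta> *\<^sub>R (- axis k 1)) $ k' = 0"
  proof -
    have "\<forall>\<^sub>F \<delta> in at_right 0. t $ k + \<delta> * (- 1) \<le> 0"
      using t by (intro eventually_nonpos_dir) auto
    then show ?thesis by (rule eventually_mono) (use t k in \<open>simp add: axis_nth_neq\<close>)
  qed
  then obtain e where "e \<in> max_terms h t" "?w \<bullet> (- axis k 1) \<le> real_vec e \<bullet> (- axis k 1)"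
    by (rule minimiser_direction[where P = "\<lambda>r. r $ k \<le> 0 \<and> r $ k' = 0"]) (rule min)
  then have e: "e \<in> max_terms h t" "real (e $ k) \<le> s" by (simp_all add: inner_axis)
  obtain e' where e': "e' \<in> max_terms h t" "s \<le> real (e' $ k)"
  proof (cases "t $ k = 0")
    case True
    then have "t = 0" using t_eq by simp
    then show ?thesis using that[of e0] origin s by simp
  next
    case False
    then have "\<forall>\<^sub>F \<delta> in at_right 0. (t + \<delta> *\<^sub>R axis k 1) $ k \<le> 0 \<and> (t + \<delta> *\<^sub>R axis k 1) $ k' = 0"
      using eventually_nonpos_dir[of "t $ k" 1] t k by (auto simp: axis_nth_neq)
    then obtain e' where "e' \<in> max_terms h t" "?w \<bullet> axis k 1 \<le> real_vec e' \<bullet> axis k 1"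
      by (rule minimiser_direction[where P = "\<lambda>r. r $ k \<le> 0 \<and> r $ k' = 0"]) (rule min)
    then show ?thesis using that[of e'] by (simp add: inner_axis)
  qed
  obtain p where "p \<in> subgrads t" "p $ k = s"
    using convex_nth_between[OF convex_subgrads active_subgrads active_subgrads, of e t e' k s] e e'
    by (auto simp: max_terms_eq_active)
  then show ?thesis using that[of "t $ k" p] t t_eq by simp
qed

text \<open>Compare \<open>w\<close> with a subgradient \<open>p\<close> on the axis that has the
  same \<open>k\<close>-th coordinate. If \<open>w\<close> were higher, monotonicity would force
  \<open>t\<close> onto the axis, where subgradients lie on the graph.\<close>

lemma subgrads_below_axis_interp:
  assumes k: "k \<noteq> k'" and t: "t \<in> quadrant" and w: "w \<in> subgrads t"
    and wk: "0 \<le> w $ k" "w $ k \<le> real (e0 $ k)"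
  shows "w $ k' \<le> lin_interp (axis_vertex k k') (w $ k)"
proof (rule ccontr)
  assume contr: "\<not> ?thesis"
  obtain x p where x: "x \<le> 0" and p: "p \<in> subgrads (x *\<^sub>R axis k 1)" "p $ k = w $ k"
    using axis_subgrad_exists[OF k wk] by blast
  have "p $ k' = lin_interp (axis_vertex k k') (w $ k)"
    using subgrads_axis_lin_interp[OF x p(1)] p(2) by simp
  then have lt: "p $ k' < w $ k'" using contr by simp
  have "0 \<le> (w - p) \<bullet> (t - x *\<^sub>R axis k 1)" by (rule subgrads_monotone[OF w p(1)])
  then have "0 \<le> (w $ k' - p $ k') * t $ k'"
    using p(2) k by (simp add: inner_vec2[OF k] axis_nth_neq)
  then have "0 \<le> t $ k'" using lt by (simp add: zero_le_mult_iff)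
  then have tk: "t $ k \<le> 0" "t $ k' = 0" using t k by (auto simp: quadrant_iff[OF k])
  then have "t = t $ k *\<^sub>R axis k 1"
    using k by (intro vec2_eqI[OF k]) (auto simp: axis_nth_neq)
  then have "w $ k' = lin_interp (axis_vertex k k') (w $ k)"
    using subgrads_axis_lin_interp[of "t $ k" w k k'] w tk by simp
  then show False using contr by simp
qed

text \<open>
  At a minimiser on the axis, the terms attaining the maximum span at most an edge; testing
  the minimum along the inward direction orthogonal to that edge puts \<open>w\<close> above it.
\<close>

lemma axis_minimiser_above:
  assumes k: "k \<noteq> k'" and x: "x < 0" and t: "t = x *\<^sub>R axis k 1"
    and min: "\<And>s. s \<in> quadrant \<Longrightarrow> H t - w \<bullet> t \<le> H s - w \<bullet> s"
  obtains p where "p \<in> subgrads t" "p $ k = w $ k" "p $ k' \<le> w $ k'"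
proof -
  have feas: "\<forall>\<^sub>F \<delta> in at_right 0. t + \<delta> *\<^sub>R d \<in> quadrant" if "d $ k' \<le> 0" for d
  proof -
    have "\<forall>\<^sub>F \<delta> in at_right 0. x + \<delta> * d $ k \<le> 0" "\<forall>\<^sub>F \<delta> in at_right 0. 0 + \<delta> * d $ k' \<le> 0"
      using eventually_nonpos_dir[of x "d $ k"] eventually_nonpos_dir[of 0 "d $ k'"] x that by auto
    then show ?thesis
      by eventually_elim (use k in \<open>simp add: quadrant_iff[OF k] t axis_nth_neq\<close>)
  qed
  \<comment> \<open>Steps in both directions along the axis bracket \<open>w $ k\<close> between
    exponents of active terms.\<close>
  have "\<forall>\<^sub>F \<delta> in at_right 0. t + \<delta> *\<^sub>R (- axis k 1) \<in> quadrant"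
    using k by (intro feas) (simp add: axis_nth_neq)
  then obtain e where "e \<in> max_terms h t" "w \<bullet> (- axis k 1) \<le> real_vec e \<bullet> (- axis k 1)"
    by (rule minimiser_direction[where P = "\<lambda>s. s \<in> quadrant"]) (rule min)
  then have e: "e \<in> max_terms h t" "real (e $ k) \<le> w $ k" by (simp_all add: inner_axis)
  have "\<forall>\<^sub>F \<delta> in at_right 0. t + \<delta> *\<^sub>R (axis k 1) \<in> quadrant"
    using k by (intro feas) (simp add: axis_nth_neq)
  then obtain e' where "e' \<in> max_terms h t" "w \<bullet> (axis k 1) \<le> real_vec e' \<bullet> (axis k 1)"
    by (rule minimiser_direction[where P = "\<lambda>s. s \<in> quadrant"]) (rule min)
  then have e': "e' \<in> max_terms h t" "w $ k \<le> real (e' $ k)" by (simp_all add: inner_axis)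
  obtain p where p: "p \<in> subgrads t" "p $ k = w $ k"
    using convex_nth_between[OF convex_subgrads active_subgrads active_subgrads, of e t e' k "w $ k"] e e'
    by (auto simp: max_terms_eq_active)
  obtain d where d: "d $ k' = - 1" "\<And>q. q \<in> max_terms h t \<Longrightarrow> real_vec q \<bullet> d = real_vec e \<bullet> d"
  proof (cases "\<exists>f. f \<in> max_terms h t \<and> f \<noteq> e")
    case False
    then show ?thesis using that[of "- axis k' 1"] by auto
  next
    case True
    then obtain f where f: "f \<in> max_terms h t" "f \<noteq> e" by blast
    have M: "max_terms h t = {e, f}" and df: "\<bar>real (f $ k) - real (e $ k)\<bar> = 1"
      using axis_step[of x e k f] x e(1) f unfolding t by auto
    \<comment> \<open>The slope of the edge from \<open>e\<close> to \<open>f\<close>; the vector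
      with \<open>k\<close>-th coordinate \<open>a\<close> and \<open>k'\<close>-th coordinate -1 is
      orthogonal to that edge.\<close>
    define a where "a = (real (e $ k') - real (f $ k')) / (real (e $ k) - real (f $ k))"
    have a: "a * (real (e $ k) - real (f $ k)) = real (e $ k') - real (f $ k')"
      using df by (auto simp: a_def)
    define d where "d = a *\<^sub>R axis k 1 - axis k' (1::real)"
    have "d $ k' = - 1" "d $ k = a" using k by (auto simp: d_def axis_nth_neq)
    moreover from this have "real_vec f \<bullet> d = real_vec e \<bullet> d"
      using a by (simp add: inner_vec2[OF k] algebra_simps)
    ultimately show ?thesis using that[of d] M by auto
  qed
  have "\<forall>\<^sub>F \<delta> in at_right 0. t + \<delta> *\<^sub>R d \<in> quadrant"
    by (intro feas) (simp add: d(1))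
  then obtain q where q: "q \<in> max_terms h t" "w \<bullet> d \<le> real_vec q \<bullet> d"
    by (rule minimiser_direction[where P = "\<lambda>s. s \<in> quadrant"]) (rule min)
  have "subgrads t \<subseteq> {p. d \<bullet> p = d \<bullet> real_vec e}"
    unfolding subgrads_def
    using d(2) by (intro hull_minimal convex_hyperplane) (auto simp: max_terms_eq_active inner_commute)
  then have "p \<bullet> d = real_vec q \<bullet> d" using p(1) d(2)[OF q(1)] by (auto simp: inner_commute)
  then have "w \<bullet> d \<le> p \<bullet> d" using q(2) by simp
  then have "p $ k' \<le> w $ k'" using p(2) d(1) by (simp add: inner_vec2[OF k])
  then show ?thesis using that p by blast
qed

text \<open>At an interior point every direction is feasible, so the minimum gives the growth bound
  that \<open>subgradsI\<close> asks for.\<close>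

lemma interior_minimiser:
  assumes t: "t $ 1 < 0" "t $ 2 < 0"
    and min: "\<And>s. s \<in> quadrant \<Longrightarrow> H t - w \<bullet> t \<le> H s - w \<bullet> s"
  shows "w \<in> subgrads t"
proof (rule subgradsI)
  fix d :: "real ^ 2"
  have "\<forall>\<^sub>F \<delta> in at_right 0. t $ 1 + \<delta> * d $ 1 \<le> 0" "\<forall>\<^sub>F \<delta> in at_right 0. t $ 2 + \<delta> * d $ 2 \<le> 0"
    using eventually_nonpos_dir[of "t $ 1" "d $ 1"] eventually_nonpos_dir[of "t $ 2" "d $ 2"] t by auto
  then show "\<forall>\<^sub>F \<delta> in at_right 0. H t + \<delta> * (w \<bullet> d) \<le> H (t + \<delta> *\<^sub>R d)"
  proof eventually_elim
    case (elim \<delta>)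
    then show ?case using min[of "t + \<delta> *\<^sub>R d"] by (simp add: quadrant_def inner_add_right)
  qed
qed

text \<open>The subgradient \<open>p\<close> under \<open>w\<close> lies on the graph, and
  \<open>below\<close> keeps \<open>w\<close> from being above it.\<close>

lemma axis_minimiser_subgrad:
  assumes k: "k \<noteq> k'" and x: "x < 0" and t: "t = x *\<^sub>R axis k 1"
    and min: "\<And>s. s \<in> quadrant \<Longrightarrow> H t - w \<bullet> t \<le> H s - w \<bullet> s"
    and below: "0 \<le> w $ k \<Longrightarrow> w $ k \<le> real (e0 $ k) \<Longrightarrow> w $ k' \<le> lin_interp (axis_vertex k k') (w $ k)"
  shows "w \<in> subgrads t"
proof -
  obtain p where p: "p \<in> subgrads t" "p $ k = w $ k" "p $ k' \<le> w $ k'"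
    using axis_minimiser_above[OF k x t min] by blast
  have "0 \<le> p $ k" "p $ k \<le> real (e0 $ k)" "p $ k' = lin_interp (axis_vertex k k') (p $ k)"
    using subgrads_nonneg subgrads_axis_le[of x p k] subgrads_axis_lin_interp[of x p k k'] p(1) x t by auto
  then have "p = w" using below p by (intro vec2_eqI[OF k]) auto
  then show ?thesis using p(1) by simp
qed

lemma origin_minimiser_ge:
  assumes min: "\<And>s. s \<in> quadrant \<Longrightarrow> H 0 - w \<bullet> 0 \<le> H s - w \<bullet> s"
  shows "real (e0 $ k) \<le> w $ k"
proof -
  have "\<forall>\<^sub>F \<delta> in at_right 0. 0 + \<delta> *\<^sub>R (- axis k 1) \<in> quadrant"
    using eventually_at_right_less[of "0::real"]
    by eventually_elim (auto simp: quadrant_def axis_def)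
  then obtain i where "i \<in> max_terms h 0" "w \<bullet> (- axis k 1) \<le> real_vec i \<bullet> (- axis k 1)"
    by (rule minimiser_direction[where P = "\<lambda>s. s \<in> quadrant"]) (rule min)
  then show ?thesis using origin by (simp add: inner_axis)
qed

lemma Union_subgrads_quadrant:
  "(\<Union>t\<in>quadrant. subgrads t) =
     {w. w $ 1 \<ge> 0 \<and> w $ 2 \<ge> 0} -
     {w. (0 \<le> w $ 1 \<and> w $ 1 \<le> real (e0 $ 1) \<and> w $ 2 > lin_interp (axis_vertex 1 2) (w $ 1)) \<or>
         (0 \<le> w $ 2 \<and> w $ 2 \<le> real (e0 $ 2) \<and> w $ 1 > lin_interp (axis_vertex 2 1) (w $ 2)) \<or>
         (w $ 1 > real (e0 $ 1) \<and> w $ 2 > real (e0 $ 2))}"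
  (is "?L = ?N - ?S")
proof (intro equalityI subsetI)
  fix w assume "w \<in> ?L"
  then obtain t where t: "t \<in> quadrant" and w: "w \<in> subgrads t" by blast
  have "\<not> (w $ 1 > real (e0 $ 1) \<and> w $ 2 > real (e0 $ 2))"
  proof
    assume gt: "w $ 1 > real (e0 $ 1) \<and> w $ 2 > real (e0 $ 2)"
    have t': "t $ 1 \<le> 0" "t $ 2 \<le> 0" using t by (auto simp: quadrant_def)
    \<comment> \<open>Monotonicity against the origin: two nonpositive products have a nonnegative
      sum, so \<open>t\<close> is the origin, whose only subgradient is \<open>e0\<close>.\<close>
    have "0 \<le> (w - real_vec e0) \<bullet> (t - 0)"
      using subgrads_monotone[OF w, of "real_vec e0" 0] subgrads_origin by simp
    then have "0 \<le> (w $ 1 - real (e0 $ 1)) * t $ 1 + (w $ 2 - real (e0 $ 2)) * t $ 2"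
      by (simp add: inner_vec2[of 1 2])
    moreover have "(w $ 1 - real (e0 $ 1)) * t $ 1 \<le> 0" "(w $ 2 - real (e0 $ 2)) * t $ 2 \<le> 0"
      using gt t' by (auto intro: mult_nonneg_nonpos)
    ultimately have "(w $ 1 - real (e0 $ 1)) * t $ 1 = 0" "(w $ 2 - real (e0 $ 2)) * t $ 2 = 0" by linarith+
    then have "t = 0" using gt by (simp add: vec_eq_iff forall_2)
    then show False using w subgrads_origin gt by simp
  qed
  moreover have "\<not> (0 \<le> w $ 1 \<and> w $ 1 \<le> real (e0 $ 1) \<and> w $ 2 > lin_interp (axis_vertex 1 2) (w $ 1))"
    using subgrads_below_axis_interp[of 1 2 t w] t w by auto
  moreover have "\<not> (0 \<le> w $ 2 \<and> w $ 2 \<le> real (e0 $ 2) \<and> w $ 1 > lin_interp (axis_vertex 2 1) (w $ 2))"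
    using subgrads_below_axis_interp[of 2 1 t w] t w by auto
  ultimately show "w \<in> ?N - ?S" using subgrads_nonneg[OF w] by blast
next
  fix w assume w: "w \<in> ?N - ?S"
  then have pos: "0 \<le> w $ 1" "0 \<le> w $ 2" by auto
  then obtain t where t: "t \<in> quadrant" and min: "\<And>s. s \<in> quadrant \<Longrightarrow> H t - w \<bullet> t \<le> H s - w \<bullet> s"
    using quadrant_minimiser by blast
  have below1: "w $ 2 \<le> lin_interp (axis_vertex 1 2) (w $ 1)" if "w $ 1 \<le> real (e0 $ 1)"
    using w that by auto
  have below2: "w $ 1 \<le> lin_interp (axis_vertex 2 1) (w $ 2)" if "w $ 2 \<le> real (e0 $ 2)"
    using w that by auto
  have "w \<in> subgrads t"
  proof -
    consider "t $ 1 < 0" "t $ 2 < 0" | "t $ 1 < 0" "t $ 2 = 0" | "t $ 1 = 0" "t $ 2 < 0"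
      | "t $ 1 = 0" "t $ 2 = 0"
      using t by (force simp: quadrant_def)
    then show ?thesis
    proof cases
      case 1
      then show ?thesis using interior_minimiser min by blast
    next
      case 2
      then have "t = t $ 1 *\<^sub>R axis 1 1" by (simp add: vec_eq_iff forall_2 axis_def)
      then show ?thesis using axis_minimiser_subgrad[of 1 2 "t $ 1" t w] 2 min below1 by simp
    next
      case 3
      then have "t = t $ 2 *\<^sub>R axis 2 1" by (simp add: vec_eq_iff forall_2 axis_def)
      then show ?thesis using axis_minimiser_subgrad[of 2 1 "t $ 2" t w] 3 min below2 by simp
    next
      case 4
      then have t0: "t = 0" by (simp add: vec_eq_iff forall_2)
      have ge: "real (e0 $ k) \<le> w $ k" for k
        using origin_minimiser_ge[of w k] min unfolding t0 by blast
      \<comment> \<open>Both graphs end at \<open>e0\<close>, which turns equality in one coordinate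
        into equality in the other.\<close>
      have vertex: "real (e0 $ k') = lin_interp (axis_vertex k k') (real (e0 $ k))" for k k'
        using subgrads_axis_lin_interp[of 0 "real_vec e0" k k'] subgrads_origin by simp
      have "w $ 1 = real (e0 $ 1) \<or> w $ 2 = real (e0 $ 2)"
        using w ge[of 1] ge[of 2] by auto
      then have "w $ 1 = real (e0 $ 1) \<and> w $ 2 = real (e0 $ 2)"
      proof
        assume eq: "w $ 1 = real (e0 $ 1)"
        then have "w $ 2 \<le> real (e0 $ 2)" using below1 vertex[of 2 1] by simp
        then show ?thesis using eq ge[of 2] by simp
      next
        assume eq: "w $ 2 = real (e0 $ 2)"
        then have "w $ 1 \<le> real (e0 $ 1)" using below2 vertex[of 1 2] by simp
        then show ?thesis using eq ge[of 1] by simp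
      qed
      then have "w = real_vec e0" by (simp add: vec_eq_iff forall_2)
      then show ?thesis using subgrads_origin t0 by simp
    qed
  qed
  then show "w \<in> ?L" using t by blast
qed

section \<open>Marked cells and subdifferentials\<close>

lemma dual_subdivision_eq: "dual_subdivision h = proj_bounded_faces hypograph"
  unfolding dual_subdivision_def hypograph_def by (simp only: le_coeff_iff)

text \<open>\<open>t\<close> itself witnesses the marking: extreme points of the hull are exponents
  of terms active at \<open>t\<close>.\<close>

lemma subgrads_marked:
  assumes "t \<in> quadrant"
  shows "subgrads t \<in> marked_complex h"
proof -
  have "t \<in> dual_cell h (subgrads t)"
    unfolding dual_cell_def
  proof (intro CollectI allI impI)
    fix e assume "real_vec e extreme_point_of subgrads t"
    then have "real_vec e \<in> real_vec ` active t"
      unfolding subgrads_def by (rule extreme_point_of_convex_hull)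
    then show "e \<in> max_terms h t" by (auto simp: max_terms_eq_active)
  qed
  then show ?thesis
    using assms subgrads_cell[of t]
    unfolding marked_complex_def dual_subdivision_eq quadrant_def by blast
qed

text \<open>A marked cell comes with a point \<open>t\<close> of the quadrant at which all its
  extreme points are active exponents; being a polytope, the cell lies in
  \<open>subgrads t\<close>.\<close>

lemma Union_marked_complex: "\<Union> (marked_complex h) = (\<Union>t\<in>quadrant. subgrads t)"
proof
  show "(\<Union>t\<in>quadrant. subgrads t) \<subseteq> \<Union> (marked_complex h)"
    using subgrads_marked by blast
  have "\<exists>t\<in>quadrant. Q \<subseteq> subgrads t" if Q: "Q \<in> marked_complex h" for Q
  proof -
    obtain t where t: "t \<in> quadrant" "t \<in> dual_cell h Q"
      using Q unfolding marked_complex_def quadrant_def by blast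
    obtain J where J: "J \<subseteq> trop_supp h" "Q = convex hull (real_vec ` J)"
      using Q cell_hull unfolding marked_complex_def dual_subdivision_eq by blast
    then have "finite (real_vec ` J)" using finite_I finite_subset by blast
    then have Q_eq: "Q = convex hull {x. x extreme_point_of Q}"
      unfolding J(2) by (rule Krein_Milman_polytope)
    have "{x. x extreme_point_of Q} \<subseteq> real_vec ` active t"
    proof clarify
      fix x assume x: "x extreme_point_of Q"
      then obtain e where e: "x = real_vec e"
        unfolding J(2) using extreme_point_of_convex_hull by blast
      then show "x \<in> real_vec ` active t"
        using t(2) x unfolding dual_cell_def by (auto simp: max_terms_eq_active)
    qed
    then have "Q \<subseteq> subgrads t" unfolding subgrads_def by (subst Q_eq) (rule hull_mono)
    then show ?thesis using t(1) by blast
  qed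
  then show "\<Union> (marked_complex h) \<subseteq> (\<Union>t\<in>quadrant. subgrads t)" by blast
qed

text \<open>At a point with a single maximal term the subdifferential is \<open>{v}\<close>, so the
  vertex is marked as soon as this point is in the quadrant.\<close>

lemma marked_vertex_meeting_iff:
  assumes "A \<subseteq> quadrant"
  shows "marked_vertex_meeting h A v \<longleftrightarrow> (\<exists>e t. real_vec e = v \<and> t \<in> A \<and> max_terms h t = {e})"
proof
  assume "marked_vertex_meeting h A v"
  then show "\<exists>e t. real_vec e = v \<and> t \<in> A \<and> max_terms h t = {e}"
    unfolding marked_vertex_meeting_def corresponds_def by blast
next
  assume "\<exists>e t. real_vec e = v \<and> t \<in> A \<and> max_terms h t = {e}"
  then obtain e t where et: "real_vec e = v" "t \<in> A" "max_terms h t = {e}" by blast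
  then have "subgrads t = {v}" by (simp add: subgrads_def max_terms_eq_active)
  then have "{v} \<in> marked_complex h" using subgrads_marked[of t] et assms by auto
  then show "marked_vertex_meeting h A v"
    using et corresponds_exists[OF et(3)] unfolding marked_vertex_meeting_def by blast
qed

lemma u_vertex_eq: "u_vertex h = axis_vertex 1 2"
proof
  fix i
  have ax: "{t :: real ^ 2. t $ 1 \<le> 0 \<and> t $ 2 = 0} = (\<lambda>x. x *\<^sub>R axis 1 1) ` {..0}"
    by (force simp: image_iff vec_eq_iff forall_2 axis_def)
  have v: "real_vec e = vector [real i, of_int l] \<longleftrightarrow> e $ 1 = i \<and> int (e $ 2) = l" for e :: "nat ^ 2" and l
    by (auto simp: vec_eq_iff forall_2)
  have "marked_vertex_meeting h {t. t $ 1 \<le> 0 \<and> t $ 2 = 0} (vector [real i, of_int l]) \<longleftrightarrow>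
      (\<exists>e x. x \<le> 0 \<and> max_terms h (x *\<^sub>R axis 1 1) = {e} \<and> e $ 1 = i \<and> int (e $ 2) = l)" for l
    by (subst marked_vertex_meeting_iff) (auto simp: quadrant_def ax v axis_nth_neq)
  then show "u_vertex h i = axis_vertex 1 2 i"
    by (simp add: u_vertex_def axis_vertex_def)
qed

lemma r_vertex_eq: "r_vertex h = axis_vertex 2 1"
proof
  fix j
  have ax: "{t :: real ^ 2. t $ 1 = 0 \<and> t $ 2 \<le> 0} = (\<lambda>x. x *\<^sub>R axis 2 1) ` {..0}"
    by (force simp: image_iff vec_eq_iff forall_2 axis_def)
  have v: "real_vec e = vector [of_int l, real j] \<longleftrightarrow> e $ 2 = j \<and> int (e $ 1) = l" for e :: "nat ^ 2" and l
    by (auto simp: vec_eq_iff forall_2)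
  have "marked_vertex_meeting h {t. t $ 1 = 0 \<and> t $ 2 \<le> 0} (vector [of_int l, real j]) \<longleftrightarrow>
      (\<exists>e x. x \<le> 0 \<and> max_terms h (x *\<^sub>R axis 2 1) = {e} \<and> e $ 2 = j \<and> int (e $ 1) = l)" for l
    by (subst marked_vertex_meeting_iff) (auto simp: quadrant_def ax v axis_nth_neq)
  then show "r_vertex h j = axis_vertex 2 1 j"
    by (simp add: r_vertex_def axis_vertex_def)
qed

end

section \<open>From three variables to the plane z = 0\<close>

lemma real_vec_in_standard_triangle:
  assumes "e $ 1 + e $ 2 \<le> m"
  shows "real_vec (e :: nat ^ 2) \<in> convex hull {vector [0, 0], vector [real m, 0], vector [0, real m]}"
proof (cases "m = 0")
  case True
  then have "real_vec e = vector [0, 0]" using assms by (simp add: vec_eq_iff forall_2)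
  then show ?thesis by (simp add: hull_inc)
next
  case False
  let ?a = "real (e $ 1) / real m" and ?b = "real (e $ 2) / real m"
  have "real (e $ 1) + real (e $ 2) \<le> real m" using assms by linarith
  then have "?a + ?b \<le> 1" using False by (simp add: add_divide_distrib[symmetric])
  moreover have "real_vec e = (1 - ?a - ?b) *\<^sub>R vector [0, 0] + ?a *\<^sub>R vector [real m, 0] + ?b *\<^sub>R vector [0, real m]"
    using False by (simp add: vec_eq_iff forall_2)
  ultimately show ?thesis
    unfolding convex_hull_3
    by (intro CollectI exI[of _ "1 - ?a - ?b"] exI[of _ ?a] exI[of _ ?b]) auto
qed

lemma standard_triangle_nonneg:
  "convex hull {vector [0, 0], vector [real m, 0], vector [0, real m]} \<subseteq>
    {t :: real ^ 2. t $ 1 \<ge> 0 \<and> t $ 2 \<ge> 0}"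
proof (rule hull_minimal)
  have "{t :: real ^ 2. t $ 1 \<ge> 0 \<and> t $ 2 \<ge> 0} = {t. axis 1 1 \<bullet> t \<ge> 0} \<inter> {t. axis 2 1 \<bullet> t \<ge> 0}"
    by (auto simp: inner_axis')
  then show "convex {t :: real ^ 2. t $ 1 \<ge> 0 \<and> t $ 2 \<ge> 0}"
    by (simp add: convex_Int convex_halfspace_ge)
qed auto

text \<open>Every nonzero exponent has coordinate sum at least 1, so without the zero exponent the
  Newton polytope would miss the origin.\<close>

lemma zero_in_newt_imp_supp:
  assumes "0 \<in> newt p"
  shows "0 \<in> trop_supp p"
proof (rule ccontr)
  assume "0 \<notin> trop_supp p"
  have "real_vec ` trop_supp p \<subseteq> {x. (\<chi> i. 1) \<bullet> x \<ge> 1}"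
  proof clarify
    fix e assume e: "e \<in> trop_supp p"
    then have "e \<noteq> 0" using \<open>0 \<notin> trop_supp p\<close> by auto
    then obtain i where "e $ i \<noteq> 0" by (auto simp: vec_eq_iff)
    then have "1 \<le> real (e $ i)" by simp
    also have "\<dots> \<le> (\<Sum>i\<in>UNIV. real (e $ i))" by (intro member_le_sum) auto
    finally show "1 \<le> (\<chi> i. 1) \<bullet> real_vec e" by (simp add: inner_vec_def)
  qed
  then have "newt p \<subseteq> {x. (\<chi> i. 1) \<bullet> x \<ge> 1}"
    unfolding newt_def by (rule hull_minimal) (rule convex_halfspace_ge)
  then show False using assms by auto
qed

locale bounded_degree = smooth_plane_section g for g :: "nat ^ 3 \<Rightarrow> ereal" +
  fixes m :: nat
  assumes degree: "e \<in> trop_supp g \<Longrightarrow> e $ 1 + e $ 2 + e $ 3 \<le> m"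
    and zero_in_supp: "0 \<in> trop_supp g"
begin

abbreviation h :: "nat ^ 2 \<Rightarrow> ereal" where "h \<equiv> restrict_z0 m g"

definition drop3 :: "nat ^ 3 \<Rightarrow> nat ^ 2" where "drop3 e = vector [e $ 1, e $ 2]"

definition plane_point :: "real ^ 2 \<Rightarrow> real ^ 3" where "plane_point t = vector [t $ 1, t $ 2, 0]"

lemma drop3_nth [simp]: "drop3 e $ 1 = e $ 1" "drop3 e $ 2 = e $ 2"
  by (simp_all add: drop3_def)

lemma inner_plane_point: "real_vec e \<bullet> plane_point t = real_vec (drop3 e) \<bullet> t"
  by (simp add: plane_point_def inner_vec_def sum_2 sum_3)

lemma restrict_ge:
  assumes "e \<in> trop_supp g"
  shows "g e \<le> h (drop3 e)"
proof -
  have d: "e $ 1 + e $ 2 + e $ 3 \<le> m" by (rule degree[OF assms])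
  have "vector [e $ 1, e $ 2, e $ 3] = e" by (simp add: vec_eq_iff forall_3)
  then have "g e \<in> (\<lambda>c. g (vector [e $ 1, e $ 2, c])) ` {0..m - (e $ 1 + e $ 2)}"
    using d by (intro image_eqI[of _ _ "e $ 3"]) auto
  then show ?thesis using d by (auto simp: restrict_z0_def intro: Max_ge)
qed

lemma restrict_attained:
  assumes "h f \<noteq> -\<infinity>"
  obtains e where "drop3 e = f" "g e = h f"
proof -
  have le: "f $ 1 + f $ 2 \<le> m" using assms by (auto simp: restrict_z0_def split: if_splits)
  have "h f \<in> (\<lambda>c. g (vector [f $ 1, f $ 2, c])) ` {0..m - (f $ 1 + f $ 2)}"
    using le Max_in[of "(\<lambda>c. g (vector [f $ 1, f $ 2, c])) ` {0..m - (f $ 1 + f $ 2)}"]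
    by (simp add: restrict_z0_def)
  then obtain c where "h f = g (vector [f $ 1, f $ 2, c])" by blast
  moreover have "drop3 (vector [f $ 1, f $ 2, c]) = f" by (simp add: drop3_def vec_eq_iff forall_2)
  ultimately show ?thesis using that by metis
qed

lemma supp_restrict: "trop_supp h = drop3 ` trop_supp g"
proof (intro equalityI subsetI)
  fix f assume "f \<in> trop_supp h"
  then show "f \<in> drop3 ` trop_supp g"
    using restrict_attained[of f] by (force simp: trop_supp_def)
next
  fix f assume "f \<in> drop3 ` trop_supp g"
  then obtain e where e: "e \<in> trop_supp g" "f = drop3 e" by blast
  then show "f \<in> trop_supp h" using restrict_ge[OF e(1)] by (auto simp: trop_supp_def)
qed

sublocale R: tropical_polynomial h
proof
  have "h f \<noteq> \<infinity>" for f
  proof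
    assume "h f = \<infinity>"
    then show False using restrict_attained[of f] trop_poly by (auto simp: trop_poly_def)
  qed
  moreover have "finite (trop_supp h)" using finite_I supp_restrict by simp
  ultimately show "trop_poly h" by (simp add: trop_poly_def)
  show "trop_supp h \<noteq> {}" using supp_nonempty supp_restrict by simp
qed

lemma supp_attained:
  assumes "f \<in> trop_supp h"
  obtains e where "e \<in> trop_supp g" "drop3 e = f" "real_coeff g e = real_coeff h f"
  using restrict_attained[of f] assms that by (metis (mono_tags) mem_Collect_eq real_coeff_def trop_supp_def)

lemma real_coeff_le:
  assumes "e \<in> trop_supp g"
  shows "real_coeff g e \<le> real_coeff h (drop3 e)"
  using restrict_ge[OF assms] assms ereal_coeff[OF assms] R.ereal_coeff[of "drop3 e"] supp_restrict
  by (metis ereal_less_eq(3) imageI)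

lemma H_restrict: "R.H t = H (plane_point t)"
proof (rule antisym)
  show "R.H t \<le> H (plane_point t)"
  proof (rule R.H_le)
    fix f assume "f \<in> trop_supp h"
    then obtain e where "e \<in> trop_supp g" "drop3 e = f" "real_coeff g e = real_coeff h f"
      by (rule supp_attained)
    then show "real_coeff h f + real_vec f \<bullet> t \<le> H (plane_point t)"
      using H_ge[of e "plane_point t"] by (simp add: inner_plane_point)
  qed
  show "H (plane_point t) \<le> R.H t"
  proof (rule H_le)
    fix e assume "e \<in> trop_supp g"
    then show "real_coeff g e + real_vec e \<bullet> plane_point t \<le> R.H t"
      using real_coeff_le[of e] R.H_ge[of "drop3 e" t] by (simp add: inner_plane_point supp_restrict)
  qed
qed

text \<open>At z = 0 the third exponent does not affect the value of a term, so only the best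
  coefficient over each planar exponent can be maximal. This lifts ties of \<open>h\<close> to ties
  of \<open>g\<close>.\<close>

lemma max_terms_restrict: "max_terms h t = drop3 ` max_terms g (plane_point t)"
  unfolding R.max_terms_eq_active max_terms_eq_active
proof (intro equalityI subsetI)
  fix f assume f: "f \<in> R.active t"
  then obtain e where "e \<in> trop_supp g" "drop3 e = f" "real_coeff g e = real_coeff h f"
    using supp_attained R.active_subset by blast
  then show "f \<in> drop3 ` active (plane_point t)"
    using f by (intro image_eqI[of _ _ e]) (auto simp: active_def R.active_def H_restrict inner_plane_point)
next
  fix f assume "f \<in> drop3 ` active (plane_point t)"
  then obtain e where e: "e \<in> trop_supp g" "f = drop3 e"
      "real_coeff g e + real_vec e \<bullet> plane_point t = H (plane_point t)"
    by (auto simp: active_def)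
  then have "f \<in> trop_supp h" using supp_restrict by blast
  then show "f \<in> R.active t"
    using real_coeff_le[OF e(1)] R.H_ge[of f t] e(2,3)
    by (simp add: R.active_def H_restrict inner_plane_point)
qed

text \<open>Distinct planar terms lift to distinct terms of \<open>g\<close> tied at the same axis
  point, so \<open>max_terms_axis\<close> applies.\<close>

lemma plane_section:
  assumes "max_terms g 0 = {e}"
  shows "planar_section h (drop3 e)"
proof
  have "drop3 0 = 0" by (simp add: vec_eq_iff forall_2)
  then show "0 \<in> trop_supp h" using zero_in_supp unfolding supp_restrict by force
  have "plane_point 0 = 0" by (simp add: plane_point_def vec_eq_iff forall_3)
  then show "max_terms h 0 = {drop3 e}" using assms by (simp add: max_terms_restrict)
next
  fix x :: real and k :: 2 and e e' :: "nat ^ 2"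
  assume x: "x \<le> 0" and e: "e \<in> max_terms h (x *\<^sub>R axis k 1)" "e' \<in> max_terms h (x *\<^sub>R axis k 1)" "e \<noteq> e'"
  \<comment> \<open>The axis keeps its number; \<open>j\<close> is \<open>k\<close> in the index
    type of three coordinates.\<close>
  obtain j :: 3 where j: "plane_point (x *\<^sub>R axis k 1) = x *\<^sub>R axis j 1" "\<And>f. drop3 f $ k = f $ j"
  proof (cases "k = 1")
    case True
    then show ?thesis using that[of 1] by (simp add: plane_point_def vec_eq_iff forall_3 axis_def)
  next
    case False
    then have "k = 2" using exhaust_2[of k] by blast
    then show ?thesis using that[of 2] by (simp add: plane_point_def vec_eq_iff forall_3 axis_def)
  qed
  obtain f f' where f: "f \<in> max_terms g (x *\<^sub>R axis j 1)" "f' \<in> max_terms g (x *\<^sub>R axis j 1)"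
      "e = drop3 f" "e' = drop3 f'"
    using e(1,2) unfolding max_terms_restrict j(1) by blast
  then have "f \<noteq> f'" using e(3) by auto
  then show "\<bar>real (e' $ k) - real (e $ k)\<bar> = 1 \<and> max_terms h (x *\<^sub>R axis k 1) = {e, e'}"
    using max_terms_axis[OF x f(1,2)] f(3,4) by (simp add: max_terms_restrict j)
qed

end

theorem proposition4p16:
  fixes m a0 b0 c0 :: nat
    and g :: "nat ^ 3 \<Rightarrow> ereal"
    and h :: "nat ^ 2 \<Rightarrow> ereal"
    and u r :: "real \<Rightarrow> real"
    and \<Delta> U R W :: "(real ^ 2) set"
  assumes g_poly: "trop_poly g"
    and g_degree: "\<And>e. e \<in> trop_supp g \<Longrightarrow> e $ 1 + e $ 2 + e $ 3 \<le> m"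
    and g_newt: "newt g = convex hull
          {vector [0, 0, 0], vector [real m, 0, 0], vector [0, real m, 0], vector [0, 0, real m]}"
    and smooth: "smooth_complete_intersection trop_plane g"
    and origin: "exponent_at g 0 = vector [a0, b0, c0]"
    and h_eq: "h = restrict_z0 m g"
    and u_eq: "u = lin_interp (u_vertex h)"
    and r_eq: "r = lin_interp (r_vertex h)"
    and \<Delta>_eq: "\<Delta> = convex hull {vector [0, 0], vector [real m, 0], vector [0, real m]}"
    and U_eq: "U = {t. 0 \<le> t $ 1 \<and> t $ 1 \<le> real a0 \<and> t $ 2 > u (t $ 1)}"
    and R_eq: "R = {t. 0 \<le> t $ 2 \<and> t $ 2 \<le> real b0 \<and> t $ 1 > r (t $ 2)}"
    and W_eq: "W = {t. t $ 1 > real a0 \<and> t $ 2 > real b0}"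
  shows "\<Union> (marked_complex h) =
           {t. t $ 1 \<ge> 0 \<and> t $ 2 \<ge> 0} -
           {t. (0 \<le> t $ 1 \<and> t $ 1 \<le> real a0 \<and> t $ 2 > u (t $ 1)) \<or>
               (0 \<le> t $ 2 \<and> t $ 2 \<le> real b0 \<and> t $ 1 > r (t $ 2)) \<or>
               (t $ 1 > real a0 \<and> t $ 2 > real b0)}
       \<and> \<Union> (marked_complex h) = \<Delta> - (U \<union> R \<union> W)"
proof -
  have "(0 :: real ^ 3) = vector [0, 0, 0]" by (simp add: vec_eq_iff forall_3)
  then have "0 \<in> newt g" unfolding g_newt by (simp add: hull_inc)
  then have zero: "0 \<in> trop_supp g" by (rule zero_in_newt_imp_supp)
  interpret G: bounded_degree g m
    using g_poly zero smooth g_degree by unfold_locales auto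
  obtain e where e: "max_terms g 0 = {e}"
    using G.active_nonempty[of 0] G.max_terms_origin unfolding G.max_terms_eq_active[symmetric] by blast
  then have "e = vector [a0, b0, c0]" using origin G.exponent_at_eq by simp
  then have e_nth: "G.drop3 e $ 1 = a0" "G.drop3 e $ 2 = b0" by simp_all
  interpret S: planar_section h "G.drop3 e"
    unfolding h_eq by (rule G.plane_section[OF e])
  have region: "\<Union> (marked_complex h) =
      {t. t $ 1 \<ge> 0 \<and> t $ 2 \<ge> 0} -
      {t. (0 \<le> t $ 1 \<and> t $ 1 \<le> real a0 \<and> t $ 2 > u (t $ 1)) \<or>
          (0 \<le> t $ 2 \<and> t $ 2 \<le> real b0 \<and> t $ 1 > r (t $ 2)) \<or>
          (t $ 1 > real a0 \<and> t $ 2 > real b0)}"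
    unfolding S.Union_marked_complex S.Union_subgrads_quadrant u_eq r_eq S.u_vertex_eq S.r_vertex_eq e_nth ..
  have "S.subgrads t \<subseteq> \<Delta>" for t
    unfolding S.subgrads_def \<Delta>_eq
  proof (rule hull_minimal)
    have "f $ 1 + f $ 2 \<le> m" if "f \<in> trop_supp h" for f
      using that g_degree unfolding h_eq G.supp_restrict by fastforce
    then show "real_vec ` S.active t \<subseteq> convex hull {vector [0, 0], vector [real m, 0], vector [0, real m]}"
      using S.active_subset[of t] real_vec_in_standard_triangle by blast
  qed simp
  then have "\<Union> (marked_complex h) \<subseteq> \<Delta>" unfolding S.Union_marked_complex by blast
  moreover have "\<Delta> \<subseteq> {t. t $ 1 \<ge> 0 \<and> t $ 2 \<ge> 0}"
    unfolding \<Delta>_eq by (rule standard_triangle_nonneg)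
  \<comment> \<open>The marked complex lies in \<open>\<Delta>\<close>, and \<open>\<Delta>\<close>
    in the nonnegative quadrant, so cutting the same region out of either gives the same
    set.\<close>
  ultimately have "\<Union> (marked_complex h) = \<Delta> - (U \<union> R \<union> W)"
    using region unfolding U_eq R_eq W_eq by blast
  then show ?thesis using region by blast
qed

end
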